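(* Let $f\in K[X,Y]$ be irreducible and monic in $Y$ of degree $n$ in $Y$, let $A=K[x,y]=K[X,Y]/\langle f\rangle$, and suppose that $P=\langle x,y\rangle\in\operatorname{Sing}(A)$. Let $$\mathcal{B}=\left\{1=p_0,\frac{p_1}{X^{e_1}},\ldots,\frac{p_{n-1}}{X^{e_{n-1}}}\right\}$$ represent an integral basis for $f$ of monic triangular type. Suppose that $P$ is the only singularity at $X=0$. Then $\mathcal{B}$ also represents a set of $K[x]$-module generators for the minimal local contribution to $\overline{A}$ at $P$.
   Context: $K$ is a field of characteristic zero; $x,y$ denote residue classes of $X,Y$ modulo $f$; $\overline{A}$ is the normalization of $A$, i.e. its integral closure in its field of fractions $K(x)[y]$. $\operatorname{Sing}(A)=\{Q\in\operatorname{Spec}(A)\mid A_Q\text{ is not regular}\}$ (a finite set). "$P$ is the only singularity at $X=0$" means: if $Q\in\operatorname{Sing}(A)$ and $\langle x\rangle\subset Q$, then $Q=P$. A local contribution to $\overline{A}$ at $P\in\operatorname{Sing}(A)$ is an intermediate ring $A\subset A'\subset\overline{A}$ with $A'_P=\overline{A_P}$, where for $Q\in\operatorname{Spec}(A)$, $A'_Q$ denotes the localization of $A'$ at $A\setminus Q$. It is the minimal local contribution if in addition $A'_Q=A_Q$ for every $Q\in\operatorname{Sing}(A)$ with $Q\ne P$; the minimal local contribution is uniquely determined. An integral basis for $f$ is a set of free generators of the $K[[x]]$-module $\overline{K[[X]][Y]/\langle f\rangle}$ (integral closure in the total ring of fractions $K((X))[Y]/\langle f\rangle$; this is a free $K[[x]]$-module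 of rank $n$). A set of elements of $K((X))[Y]$ represents an integral basis for $f$ if their residue classes modulo $f$ form one. It is of monic triangular type if it has the displayed form with $p_d\in K[X][Y]$ monic of degree $d$ in $Y$ and $e_d$ integers. *)

theory Defs
  imports "HOL-Library.Extended_Nat" "HOL-Algebra.Algebra"
    "HOL-Algebra.Algebraic_Closure_Type" "HOL-Computational_Algebra.Computational_Algebra"
begin

text \<open>
  The polynomial ring \<open>K[X,Y] = K[X][Y]\<close> is the type \<^typ>\<open>'k poly poly\<close>, with \<open>X = [:[:0, 1:]:]\<close>
  and \<open>Y = [:0, 1:]\<close>; \<open>K(X)\<close> is \<^typ>\<open>'k poly fract\<close>, \<open>K[[X]]\<close> is \<^typ>\<open>'k fps\<close> and \<open>K((X))\<close> is
  \<^typ>\<open>'k fls\<close>.  The quotients depend on the polynomial \<open>f\<close>, so they are ring records;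
  their subrings and their localizations are sets of elements.
\<close>

section \<open>Commutative algebra\<close>

definition Spec :: "('a, 'b) ring_scheme \<Rightarrow> 'a set set" where
  "Spec R = {Q. primeideal Q R}"

definition krull_dim :: "('a, 'b) ring_scheme \<Rightarrow> enat" where
  "krull_dim R = Sup {enat m | m. \<exists>C :: nat \<Rightarrow> 'a set.
     (\<forall>i\<le>m. C i \<in> Spec R) \<and> (\<forall>i<m. C i \<subset> C (Suc i))}"

definition min_generators :: "('a, 'b) ring_scheme \<Rightarrow> 'a set \<Rightarrow> enat" where
  "min_generators R I = Inf {enat (card S) | S. finite S \<and> S \<subseteq> carrier R \<and> genideal R S = I}"

definition regular_local_ring :: "('a, 'b) ring_scheme \<Rightarrow> bool" where
  "regular_local_ring R \<longleftrightarrow> cring R \<and> noetherian_ring R \<and>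
     (\<exists>\<mm>. maximalideal \<mm> R \<and> (\<forall>\<nn>. maximalideal \<nn> R \<longrightarrow> \<nn> = \<mm>) \<and>
          min_generators R \<mm> = krull_dim R)"

definition integral_over :: "('a, 'b) ring_scheme \<Rightarrow> 'a set \<Rightarrow> 'a \<Rightarrow> bool" where
  "integral_over R S z \<longleftrightarrow>
     (\<exists>p \<in> carrier (univ_poly R S). p \<noteq> [] \<and> hd p = \<one>\<^bsub>R\<^esub> \<and> ring.eval R p z = \<zero>\<^bsub>R\<^esub>)"

definition integral_closure :: "('a, 'b) ring_scheme \<Rightarrow> 'a set \<Rightarrow> 'a set" where
  "integral_closure R S = {z \<in> carrier R. integral_over R S z}"

text \<open>
  The localization of \<open>M\<close> at \<open>A \<setminus> Q\<close>, where \<open>A \<subseteq> M\<close> are subrings of the field \<open>L\<close>, formed inside \<open>L\<close>.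
\<close>

definition localization_at :: "('a, 'b) ring_scheme \<Rightarrow> 'a set \<Rightarrow> 'a set \<Rightarrow> 'a set \<Rightarrow> 'a set" where
  "localization_at L A M Q = {a \<otimes>\<^bsub>L\<^esub> inv\<^bsub>L\<^esub> s | a s. a \<in> M \<and> s \<in> A - Q}"

definition Sing :: "('a, 'b) ring_scheme \<Rightarrow> 'a set \<Rightarrow> 'a set set" where
  "Sing L A = {Q \<in> Spec (L\<lparr>carrier := A\<rparr>).
     \<not> regular_local_ring (L\<lparr>carrier := localization_at L A A Q\<rparr>)}"

text \<open>In the next two definitions \<open>L\<close> is the field of fractions of the domain \<open>A\<close>.\<close>

definition local_contribution ::
  "('a, 'b) ring_scheme \<Rightarrow> 'a set \<Rightarrow> 'a set \<Rightarrow> 'a set \<Rightarrow> bool" where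
  "local_contribution L A P A' \<longleftrightarrow>
     P \<in> Sing L A \<and> subring A' L \<and> A \<subseteq> A' \<and> A' \<subseteq> integral_closure L A \<and>
     localization_at L A A' P = integral_closure L (localization_at L A A P)"

definition minimal_local_contribution ::
  "('a, 'b) ring_scheme \<Rightarrow> 'a set \<Rightarrow> 'a set \<Rightarrow> 'a set \<Rightarrow> bool" where
  "minimal_local_contribution L A P A' \<longleftrightarrow>
     local_contribution L A P A' \<and>
     (\<forall>Q \<in> Sing L A. Q \<noteq> P \<longrightarrow> localization_at L A A' Q = localization_at L A A Q)"

text \<open>Modules over a subring \<open>S\<close> of \<open>R\<close> that are contained in \<open>R\<close>.\<close>

definition module_span :: "('a, 'b) ring_scheme \<Rightarrow> 'a set \<Rightarrow> 'a set \<Rightarrow> 'a set" where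
  "module_span R S B =
     {\<Oplus>\<^bsub>R\<^esub>b\<in>F. c b \<otimes>\<^bsub>R\<^esub> b | c F. finite F \<and> F \<subseteq> B \<and> c \<in> F \<rightarrow> S}"

definition module_independent :: "('a, 'b) ring_scheme \<Rightarrow> 'a set \<Rightarrow> 'a set \<Rightarrow> bool" where
  "module_independent R S B \<longleftrightarrow>
     (\<forall>F c. finite F \<and> F \<subseteq> B \<and> c \<in> F \<rightarrow> S \<and> (\<Oplus>\<^bsub>R\<^esub>b\<in>F. c b \<otimes>\<^bsub>R\<^esub> b) = \<zero>\<^bsub>R\<^esub>
        \<longrightarrow> (\<forall>b\<in>F. c b = \<zero>\<^bsub>R\<^esub>))"

definition free_generators ::
  "('a, 'b) ring_scheme \<Rightarrow> 'a set \<Rightarrow> 'a set \<Rightarrow> 'a set \<Rightarrow> bool" where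
  "free_generators R S M B \<longleftrightarrow>
     B \<subseteq> M \<and> module_span R S B = M \<and> module_independent R S B"

section \<open>Quotients of univariate polynomial rings over a field\<close>

definition poly_quot :: "'c::field poly \<Rightarrow> 'c poly set ring" where
  "poly_quot g = ring_of_type_algebra Quot (PIdl\<^bsub>ring_of_type_algebra\<^esub> g)"

definition residue :: "'c::field poly \<Rightarrow> 'c poly \<Rightarrow> 'c poly set" where
  "residue g h = (PIdl\<^bsub>ring_of_type_algebra\<^esub> g) +>\<^bsub>ring_of_type_algebra\<^esub> h"

definition residue_consts :: "'c::field poly \<Rightarrow> 'c set \<Rightarrow> 'c poly set set" where
  "residue_consts g S = {residue g [:c:] | c. c \<in> S}"

definition residue_polys :: "'c::field poly \<Rightarrow> 'c set \<Rightarrow> 'c poly set set" where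
  "residue_polys g S = {residue g h | h. \<forall>i. Polynomial.coeff h i \<in> S}"

section \<open>The affine coordinate ring of a plane curve\<close>

abbreviation emb_ratfun :: "'k::field poly \<Rightarrow> 'k poly fract" where
  "emb_ratfun \<equiv> to_fract"

abbreviation emb_laurent :: "'k::field poly \<Rightarrow> 'k fls" where
  "emb_laurent \<equiv> \<lambda>a. fps_to_fls (fps_of_poly a)"

text \<open>The field \<open>K(x)[y] = K(X)[Y]/\<langle>f\<rangle>\<close>, its subrings \<open>A = K[x,y]\<close> and \<open>K[x]\<close>, and \<open>x\<close> and \<open>y\<close>.\<close>

definition function_field :: "'k::field poly poly \<Rightarrow> 'k poly fract poly set ring" where
  "function_field f = poly_quot (map_poly emb_ratfun f)"

definition coord_ring :: "'k::field poly poly \<Rightarrow> 'k poly fract poly set set" where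
  "coord_ring f = residue_polys (map_poly emb_ratfun f) (range emb_ratfun)"

definition K_x :: "'k::field poly poly \<Rightarrow> 'k poly fract poly set set" where
  "K_x f = residue_consts (map_poly emb_ratfun f) (range emb_ratfun)"

definition res_class :: "'k::field poly poly \<Rightarrow> 'k poly poly \<Rightarrow> 'k poly fract poly set" where
  "res_class f h = residue (map_poly emb_ratfun f) (map_poly emb_ratfun h)"

definition x_class :: "'k::field poly poly \<Rightarrow> 'k poly fract poly set" where
  "x_class f = res_class f [:[:0, 1:]:]"

definition y_class :: "'k::field poly poly \<Rightarrow> 'k poly fract poly set" where
  "y_class f = res_class f [:0, 1:]"

definition coord_ring_struct :: "'k::field poly poly \<Rightarrow> 'k poly fract poly set ring" where
  "coord_ring_struct f = (function_field f)\<lparr>carrier := coord_ring f\<rparr>"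

definition origin :: "'k::field poly poly \<Rightarrow> 'k poly fract poly set set" where
  "origin f = genideal (coord_ring_struct f) {x_class f, y_class f}"

lemma rta_simps: "carrier (ring_of_type_algebra :: 'c::comm_ring_1 ring) = UNIV"
  "x \<otimes>\<^bsub>ring_of_type_algebra\<^esub> y = x * (y::'c)" "x \<oplus>\<^bsub>ring_of_type_algebra\<^esub> y = x + (y::'c)"
  "\<one>\<^bsub>ring_of_type_algebra\<^esub> = (1::'c)" "\<zero>\<^bsub>ring_of_type_algebra\<^esub> = (0::'c)"
  by (simp_all add: ring_of_type_algebra_def)

lemma PIdl_rta: "PIdl\<^bsub>ring_of_type_algebra\<^esub> g = {h :: 'c::comm_ring_1. g dvd h}"
  by (auto simp: cgenideal_def rta_simps dvd_def mult.commute)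

lemma residue_ring_hom: "ring_hom_ring ring_of_type_algebra (poly_quot g) (residue g)"
proof -
  interpret rta: cring "ring_of_type_algebra :: 'a poly ring" by (rule cring_from_type_algebra)
  show ?thesis
    unfolding poly_quot_def residue_def
    by (rule ideal.rcos_ring_hom_ring[OF rta.cgenideal_ideal]) (simp add: rta_simps)
qed

lemma residue_eq_zero_iff: "residue g h = \<zero>\<^bsub>poly_quot g\<^esub> \<longleftrightarrow> g dvd h"
proof -
  interpret rta: cring "ring_of_type_algebra :: 'a poly ring" by (rule cring_from_type_algebra)
  have I: "ideal {h. g dvd h} (ring_of_type_algebra :: 'a poly ring)"
    using rta.cgenideal_ideal[of g] by (simp add: rta_simps PIdl_rta)
  have "residue g h = \<zero>\<^bsub>poly_quot g\<^esub> \<longleftrightarrow> {h. g dvd h} +>\<^bsub>ring_of_type_algebra\<^esub> h = {h. g dvd h}"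
    by (simp add: residue_def poly_quot_def FactRing_def PIdl_rta)
  also have "\<dots> \<longleftrightarrow> g dvd h"
  proof
    assume "{h. g dvd h} +>\<^bsub>ring_of_type_algebra\<^esub> h = {h. g dvd h}"
    moreover have "0 + h \<in> {h. g dvd h} +>\<^bsub>ring_of_type_algebra\<^esub> h"
      unfolding a_r_coset_def' by (auto simp: rta_simps)
    ultimately show "g dvd h" by auto
  next
    assume "g dvd h"
    thus "{h. g dvd h} +>\<^bsub>ring_of_type_algebra\<^esub> h = {h. g dvd h}"
      using rta.a_rcos_zero[OF I] by auto
  qed
  finally show ?thesis .
qed


lemma fract_poly_dvd_monic:
  fixes f h :: "'b::idom poly"
  assumes "Polynomial.lead_coeff f = 1"
  shows "fract_poly f dvd fract_poly h \<longleftrightarrow> f dvd h"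
proof
  assume *: "fract_poly f dvd fract_poly h"
  have f0: "f \<noteq> 0" using assms by auto
  obtain q r where qr: "h = f * q + r" "r = 0 \<or> Polynomial.degree r < Polynomial.degree f"
    using pseudo_divmod(1,2)[OF f0, of h "fst (pseudo_divmod h f)" "snd (pseudo_divmod h f)"] assms
    by auto
  have "fract_poly h = fract_poly f * fract_poly q + fract_poly r" by (simp add: qr(1))
  hence "fract_poly f dvd fract_poly r" using * by (metis dvd_add_right_iff dvd_triv_left)
  moreover have deg: "Polynomial.degree (fract_poly g) = Polynomial.degree g" for g :: "'b poly"
    by (rule degree_map_poly) simp
  ultimately have "fract_poly r = 0 \<or> Polynomial.degree f \<le> Polynomial.degree r"
    by (metis dvd_imp_degree_le deg)
  hence "r = 0" using qr(2) by auto
  thus "f dvd h" using qr(1) by simp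
next
  assume "f dvd h"
  thus "fract_poly f dvd fract_poly h" by (auto elim!: dvdE)
qed

text \<open>\<open>coord_ring f\<close> is the image of \<open>K[X,Y]\<close> in \<open>K(X)[Y]/\<langle>f\<rangle>\<close>; for monic \<open>f\<close> it is a copy of \<open>K[X,Y]/\<langle>f\<rangle>\<close>.\<close>

lemma coord_ring_iso:
  fixes f :: "'k::field poly poly"
  assumes "Polynomial.lead_coeff f = 1"
  shows "ring_of_type_algebra Quot (PIdl\<^bsub>ring_of_type_algebra\<^esub> f) \<simeq> coord_ring_struct f"
proof -
  interpret R: ring_hom_ring ring_of_type_algebra "function_field f" "residue (fract_poly f)"
    unfolding function_field_def by (rule residue_ring_hom)
  have hom: "ring_hom_ring ring_of_type_algebra (function_field f) (res_class f)"
  proof (rule ring_hom_ringI)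
    show "ring (function_field f)" by (rule R.S.ring_axioms)
  qed (use R.hom_closed R.hom_mult R.hom_add R.hom_one in
        \<open>auto simp: rta_simps res_class_def\<close>)
  have ker: "a_kernel ring_of_type_algebra (function_field f) (res_class f)
               = PIdl\<^bsub>ring_of_type_algebra\<^esub> f"
    unfolding a_kernel_def' PIdl_rta
    using residue_eq_zero_iff[of "fract_poly f"] fract_poly_dvd_monic[OF assms]
    by (auto simp: rta_simps res_class_def function_field_def)
  have "coord_ring f = res_class f ` carrier ring_of_type_algebra"
  proof -
    have "\<exists>g. h = fract_poly g" if "\<forall>i. Polynomial.coeff h i \<in> range to_fract"
      for h :: "'k poly fract poly"
    proof -
      have "map_poly to_fract (map_poly (inv_into UNIV to_fract) h) = h"
        using that by (intro poly_eqI) (simp add: coeff_map_poly f_inv_into_f inv_f_eq inj_def)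
      thus ?thesis by metis
    qed
    thus ?thesis
      by (auto simp: coord_ring_def residue_polys_def res_class_def rta_simps) 
         (metis coeff_map_poly to_fract_0 rangeI)+
  qed
  thus ?thesis
    using ring_hom_ring.FactRing_iso_set_aux[OF hom] ker
    by (auto simp: is_ring_iso_def coord_ring_struct_def)
qed

section \<open>Integral bases\<close>

text \<open>
  \<open>K((X))[Y]/\<langle>f\<rangle>\<close>, its subrings \<open>K[[x]]\<close> and \<open>K[[X]][Y]/\<langle>f\<rangle>\<close>, and the integral closure of the latter.
\<close>

definition laurent_quot :: "'k::field poly poly \<Rightarrow> 'k fls poly set ring" where
  "laurent_quot f = poly_quot (map_poly emb_laurent f)"

definition K_xx :: "'k::field poly poly \<Rightarrow> 'k fls poly set set" where
  "K_xx f = residue_consts (map_poly emb_laurent f) (range fps_to_fls)"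

definition power_series_quot :: "'k::field poly poly \<Rightarrow> 'k fls poly set set" where
  "power_series_quot f = residue_polys (map_poly emb_laurent f) (range fps_to_fls)"

definition represents_integral_basis :: "'k::field poly poly \<Rightarrow> 'k fls poly set \<Rightarrow> bool" where
  "represents_integral_basis f B \<longleftrightarrow>
     free_generators (laurent_quot f) (K_xx f)
       (integral_closure (laurent_quot f) (power_series_quot f))
       (residue (map_poly emb_laurent f) ` B)"

text \<open>
  The set \<open>{p\<^sub>d / X^e\<^sub>d | d < n}\<close>.  Since its elements are used both in \<open>K(X)[Y]\<close> and in
  \<open>K((X))[Y]\<close>, the embedding \<open>\<iota>\<close> of \<open>K[X]\<close> into the coefficient field is a parameter.
\<close>

definition quotient_family ::
  "('k::field poly \<Rightarrow> 'c::field) \<Rightarrow> nat \<Rightarrow> (nat \<Rightarrow> 'k poly poly) \<Rightarrow> (nat \<Rightarrow> int) \<Rightarrow> 'c poly set"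
where
  "quotient_family \<iota> n p e =
     {Polynomial.smult (inverse (\<iota> [:0, 1:] powi e d)) (map_poly \<iota> (p d)) | d. d < n}"

definition monic_triangular_data ::
  "nat \<Rightarrow> (nat \<Rightarrow> 'k::field poly poly) \<Rightarrow> (nat \<Rightarrow> int) \<Rightarrow> bool" where
  "monic_triangular_data n p e \<longleftrightarrow>
     p 0 = 1 \<and> e 0 = 0 \<and>
     (\<forall>d<n. Polynomial.degree (p d) = d \<and> Polynomial.lead_coeff (p d) = 1)"

end

theory Submission
  imports Defs
begin

text \<open>
  Let \<open>L = K(X)[Y]/\<langle>f\<rangle>\<close>, which is a field by Gauss's lemma, let \<open>b\<^sub>d = p\<^sub>d / x^e\<^sub>d\<close>, and let \<open>M\<close> be the
  \<open>K[x]\<close>-span of the \<open>b\<^sub>d\<close> in \<open>L\<close>.  The theorem follows from one description of \<open>M\<close>: it consists of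
  the elements of \<open>A[1/x]\<close> that are integral over \<open>A\<close> (\<open>module_span_integral_basis\<close>).

  To see this, consider an element \<open>h/x^k\<close> of \<open>A[1/x]\<close>.  It is integral over \<open>A\<close> if and only if it
  is integral over \<open>K[[x]][y]\<close> when regarded as an element of \<open>K((X))[Y]/\<langle>f\<rangle>\<close>.  For the nontrivial
  direction, clear denominators in an integral equation, so that it states that \<open>f\<close> divides
  \<open>h^m + \<Sum> c\<^sub>i X^(k(m-i)) h^i\<close> with coefficients \<open>c\<^sub>i\<close> over \<open>K[[X]]\<close>.  Truncating the \<open>c\<^sub>i\<close> modulo
  \<open>X^(km)\<close> changes the sum by a multiple of \<open>X^(km)\<close>, which a new constant coefficient \<open>c\<^sub>0\<close> absorbs
  (\<open>integral_fraction_fps_iff\<close>).  By assumption, the elements integral over \<open>K[[x]][y]\<close> are the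
  \<open>K[[x]]\<close>-combinations of the \<open>b\<^sub>d\<close>.  Since the \<open>b\<^sub>d\<close> are triangular with leading coefficients powers
  of \<open>x\<close>, such a combination lies in \<open>A[1/x]\<close> only if its coefficients are in \<open>K[x]\<close>
  (\<open>triangular_coefficients_polynomial\<close>).

  The required properties of \<open>M\<close> are now formal.  It contains \<open>A\<close> and is contained in the integral
  closure of \<open>A\<close>.  It is closed under sums as a span, under squares because the square of an integral
  element is integral (\<open>integral_square\<close>), and therefore under products, as \<open>2\<close> is invertible.

  At a singular prime \<open>Q \<noteq> P\<close> the element \<open>x\<close> is invertible in \<open>A\<^sub>Q\<close>, so \<open>A \<subseteq> M \<subseteq> A[1/x]\<close> gives
  \<open>M\<^sub>Q = A\<^sub>Q\<close> (\<open>localization_away\<close>).  At \<open>P\<close>, an element of \<open>L\<close> that is integral over \<open>A\<^sub>P\<close> becomes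
  integral over \<open>A\<close> after multiplication by some \<open>s\<close> outside \<open>P\<close> (\<open>integral_over_localization\<close>).  Its
  denominator in \<open>K[x]\<close> has the form \<open>x^k v(x)\<close> with \<open>v(0) \<noteq> 0\<close>; since \<open>v(x)\<close> is not in \<open>P\<close>,
  multiplication by \<open>v(x)\<close> then moves it into \<open>M\<close>.
\<close>

section \<open>Injective ring homomorphisms and polynomials\<close>

lemma monic_division:
  fixes f :: "'a::idom poly"
  assumes "Polynomial.lead_coeff f = 1"
  obtains q r where "h = f * q + r" "r = 0 \<or> Polynomial.degree r < Polynomial.degree f"
proof -
  have "f \<noteq> 0" using assms by auto
  thus ?thesis
    using pseudo_divmod(1,2)[of f h "fst (pseudo_divmod h f)" "snd (pseudo_divmod h f)"] assms that
    by auto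
qed

text \<open>
  Every change of base ring below is of this kind: \<open>K[X]\<close> is mapped to \<open>K(X)\<close>, \<open>K[[X]]\<close> and
  \<open>K((X))\<close>, and \<open>K[[X]]\<close> to \<open>K((X))\<close>, together with the maps induced on polynomials in \<open>Y\<close>.
\<close>

locale inj_ring_hom =
  fixes \<phi> :: "'a::idom \<Rightarrow> 'b::idom"
  assumes hom_add: "\<phi> (a + b) = \<phi> a + \<phi> b"
    and hom_mult: "\<phi> (a * b) = \<phi> a * \<phi> b"
    and hom_one: "\<phi> 1 = 1"
    and hom_zero_iff: "\<phi> a = 0 \<longleftrightarrow> a = 0"
begin

lemma hom_zero: "\<phi> 0 = 0"
  by (simp add: hom_zero_iff)

lemma hom_minus: "\<phi> (- a) = - \<phi> a"
  using hom_add[of a "- a"] by (simp add: hom_zero eq_neg_iff_add_eq_0 add.commute)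

lemma hom_diff: "\<phi> (a - b) = \<phi> a - \<phi> b"
  using hom_add[of a "- b"] by (simp add: hom_minus)

lemma hom_power: "\<phi> (a ^ k) = \<phi> a ^ k"
  by (induction k) (simp_all add: hom_one hom_mult)

lemma hom_sum: "\<phi> (sum h I) = (\<Sum>i\<in>I. \<phi> (h i))"
  by (induction I rule: infinite_finite_induct) (simp_all add: hom_zero hom_add)

lemma hom_eq_iff: "\<phi> a = \<phi> b \<longleftrightarrow> a = b"
  using hom_zero_iff[of "a - b"] by (simp add: hom_diff)

lemma degree_hom [simp]: "Polynomial.degree (map_poly \<phi> p) = Polynomial.degree p"
  by (rule degree_map_poly) (simp add: hom_zero_iff)

lemma coeff_hom: "Polynomial.coeff (map_poly \<phi> p) i = \<phi> (Polynomial.coeff p i)"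
  by (simp add: coeff_map_poly hom_zero)

lemma map_poly_hom: "inj_ring_hom (map_poly \<phi>)"
proof
  fix p q :: "'a poly"
  show "map_poly \<phi> (p + q) = map_poly \<phi> p + map_poly \<phi> q"
    by (rule poly_eqI) (simp add: coeff_hom hom_add)
  show "map_poly \<phi> (p * q) = map_poly \<phi> p * map_poly \<phi> q"
    by (rule poly_eqI) (simp add: coeff_hom coeff_mult hom_sum hom_mult)
  show "map_poly \<phi> 1 = 1"
    by (simp add: hom_one)
  show "map_poly \<phi> p = 0 \<longleftrightarrow> p = 0"
    by (simp add: map_poly_eq_0_iff hom_zero_iff)
qed

lemma map_poly_smult_hom: "map_poly \<phi> (Polynomial.smult c p) = Polynomial.smult (\<phi> c) (map_poly \<phi> p)"
  by (rule poly_eqI) (simp add: coeff_hom hom_mult)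

text \<open>
  The remainder of \<open>h\<close> modulo a monic \<open>f\<close> is mapped to the remainder of the images, because \<open>\<phi>\<close>
  preserves degrees.
\<close>

lemma map_poly_dvd_iff:
  assumes "Polynomial.lead_coeff f = 1"
  shows "map_poly \<phi> f dvd map_poly \<phi> h \<longleftrightarrow> f dvd h"
proof
  interpret P: inj_ring_hom "map_poly \<phi>" by (rule map_poly_hom)
  assume *: "map_poly \<phi> f dvd map_poly \<phi> h"
  obtain q r where qr: "h = f * q + r" "r = 0 \<or> Polynomial.degree r < Polynomial.degree f"
    by (rule monic_division[OF assms])
  have "map_poly \<phi> h = map_poly \<phi> f * map_poly \<phi> q + map_poly \<phi> r"
    by (simp add: qr(1) P.hom_add P.hom_mult)
  hence "map_poly \<phi> f dvd map_poly \<phi> r"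
    using * by (metis dvd_add_right_iff dvd_triv_left)
  hence "map_poly \<phi> r = 0 \<or> Polynomial.degree f \<le> Polynomial.degree r"
    using dvd_imp_degree_le[of "map_poly \<phi> f" "map_poly \<phi> r"] by auto
  hence "r = 0" using qr(2) P.hom_zero_iff[of r] by linarith
  thus "f dvd h" using qr(1) by simp
next
  interpret P: inj_ring_hom "map_poly \<phi>" by (rule map_poly_hom)
  assume "f dvd h"
  thus "map_poly \<phi> f dvd map_poly \<phi> h" by (auto elim!: dvdE simp: P.hom_mult)
qed

end

lemma inj_ring_hom_to_fract: "inj_ring_hom to_fract"
  by standard simp_all

lemma inj_ring_hom_fps_of_poly: "inj_ring_hom (fps_of_poly :: 'k::field poly \<Rightarrow> 'k fps)"
proof
  show "fps_of_poly p = 0 \<longleftrightarrow> p = 0" for p :: "'k poly"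
    using fps_of_poly_eq_iff[of p 0] by simp
qed (simp_all add: fps_of_poly_add fps_of_poly_mult)

lemma inj_ring_hom_fps_to_fls: "inj_ring_hom (fps_to_fls :: 'k::field fps \<Rightarrow> 'k fls)"
  by standard (simp_all add: fls_times_fps_to_fls)

lemma inj_ring_hom_emb_laurent: "inj_ring_hom (emb_laurent :: 'k::field poly \<Rightarrow> 'k fls)"
proof -
  interpret a: inj_ring_hom "fps_of_poly :: 'k poly \<Rightarrow> 'k fps" by (rule inj_ring_hom_fps_of_poly)
  interpret b: inj_ring_hom "fps_to_fls :: 'k fps \<Rightarrow> 'k fls" by (rule inj_ring_hom_fps_to_fls)
  show ?thesis
    by standard (simp_all add: a.hom_add a.hom_mult b.hom_add b.hom_mult a.hom_zero_iff)
qed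

section \<open>Residue classes and integral equations\<close>

lemma poly_quot_cring: "cring (poly_quot g)"
proof -
  interpret rta: cring "ring_of_type_algebra :: 'a poly ring" by (rule cring_from_type_algebra)
  have "ideal (PIdl\<^bsub>ring_of_type_algebra\<^esub> g) ring_of_type_algebra"
    by (rule rta.cgenideal_ideal) (simp add: rta_simps)
  thus ?thesis unfolding poly_quot_def
    by (rule ideal.quotient_is_cring) (rule rta.cring_axioms)
qed

lemma poly_quot_carrier: "carrier (poly_quot g) = range (residue g)"
  by (auto simp: poly_quot_def FactRing_def A_RCOSETS_def' residue_def rta_simps)

context
  fixes g :: "'c::field poly"
begin

interpretation R: cring "poly_quot g" by (rule poly_quot_cring)
interpretation h: ring_hom_ring ring_of_type_algebra "poly_quot g" "residue g"
  by (rule residue_ring_hom)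

lemma residue_closed [simp]: "residue g a \<in> carrier (poly_quot g)"
  by (simp add: poly_quot_carrier)

lemma residue_add: "residue g (a + b) = residue g a \<oplus>\<^bsub>poly_quot g\<^esub> residue g b"
  using h.hom_add[of a b] by (simp add: rta_simps)

lemma residue_mult: "residue g (a * b) = residue g a \<otimes>\<^bsub>poly_quot g\<^esub> residue g b"
  using h.hom_mult[of a b] by (simp add: rta_simps)

lemma residue_one: "residue g 1 = \<one>\<^bsub>poly_quot g\<^esub>"
  using h.hom_one by (simp add: rta_simps)

lemma residue_zero: "residue g 0 = \<zero>\<^bsub>poly_quot g\<^esub>"
  by (simp add: residue_eq_zero_iff)

lemma residue_minus: "residue g (- a) = \<ominus>\<^bsub>poly_quot g\<^esub> residue g a"
  by (rule R.minus_equality[symmetric]) (simp_all add: residue_zero flip: residue_add)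

lemma residue_power: "residue g (a ^ k) = residue g a [^]\<^bsub>poly_quot g\<^esub> k"
  by (induction k) (simp_all add: residue_one residue_mult R.m_comm)

lemma residue_eq_iff: "residue g a = residue g b \<longleftrightarrow> g dvd a - b"
proof -
  have "residue g (a - b) = residue g a \<ominus>\<^bsub>poly_quot g\<^esub> residue g b"
    using residue_add[of a "- b"] by (simp add: residue_minus a_minus_def)
  thus ?thesis using residue_eq_zero_iff[of g "a - b"] by (metis R.r_right_minus_eq residue_closed)
qed

lemma residue_sum:
  assumes "finite I"
  shows "residue g (\<Sum>i\<in>I. a i) = (\<Oplus>\<^bsub>poly_quot g\<^esub>i\<in>I. residue g (a i))"
  using assms by (induction I) (simp_all add: residue_zero residue_add)

text \<open>
  The coefficient lists of \<open>ring.eval\<close> start with the leading coefficient, hence the reversal.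
\<close>

lemma eval_residue:
  "ring.eval (poly_quot g) (map (residue g) cs) (residue g z)
     = residue g (\<Sum>i<length cs. rev cs ! i * z ^ i)"
proof (induction cs)
  case Nil
  show ?case by (simp add: residue_zero)
next
  case (Cons a cs)
  have "(\<Sum>i<length (a # cs). rev (a # cs) ! i * z ^ i)
          = a * z ^ length cs + (\<Sum>i<length cs. rev cs ! i * z ^ i)"
    by (simp add: nth_append)
  thus ?case
    by (simp add: Cons.IH residue_add residue_mult residue_power)
qed

end

text \<open>
  An integral equation in a quotient \<open>K[Y]/\<langle>g\<rangle>\<close> is a divisibility by \<open>g\<close> in \<open>K[Y]\<close>.  All later
  computations with integral elements take place on the right-hand side, with polynomials that
  represent the residue classes.
\<close>

lemma integral_over_residue_iff:
  fixes g :: "'c::field poly"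
  assumes g: "Polynomial.degree g > 0"
    and T: "T \<subseteq> carrier (poly_quot g)" "\<one>\<^bsub>poly_quot g\<^esub> \<in> T"
  shows "integral_over (poly_quot g) T (residue g z) \<longleftrightarrow>
     (\<exists>m c. (\<forall>i<m. residue g (c i) \<in> T) \<and> g dvd z ^ m + (\<Sum>i<m. c i * z ^ i))"
    (is "?L \<longleftrightarrow> ?R")
proof
  interpret R: cring "poly_quot g" by (rule poly_quot_cring)
  assume ?L
  then obtain q where q: "q \<in> carrier (univ_poly (poly_quot g) T)" "q \<noteq> []"
      "hd q = \<one>\<^bsub>poly_quot g\<^esub>" "ring.eval (poly_quot g) q (residue g z) = \<zero>\<^bsub>poly_quot g\<^esub>"
    unfolding integral_over_def by auto
  then obtain ts where ts: "q = \<one>\<^bsub>poly_quot g\<^esub> # ts" by (cases q) auto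
  have tsT: "set ts \<subseteq> T"
    using q(1) by (auto simp: univ_poly_def polynomial_def ts)
  have "\<forall>t\<in>set ts. \<exists>a. t = residue g a"
    using tsT T(1) by (auto simp: poly_quot_carrier)
  then obtain pick where pick: "\<And>t. t \<in> set ts \<Longrightarrow> t = residue g (pick t)" by metis
  define cs where "cs = map pick ts"
  have ts_cs: "ts = map (residue g) cs"
    using pick by (simp add: cs_def map_idI)
  have "residue g (z ^ length cs + (\<Sum>i<length cs. rev cs ! i * z ^ i)) = \<zero>\<^bsub>poly_quot g\<^esub>"
    using q(4) eval_residue[of g "1 # cs" z]
    by (simp add: ts ts_cs residue_one nth_append add.commute)
  hence "g dvd z ^ length cs + (\<Sum>i<length cs. rev cs ! i * z ^ i)"
    by (simp add: residue_eq_zero_iff)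
  moreover have "residue g (rev cs ! i) \<in> T" if "i < length cs" for i
    using tsT that nth_mem[of i "rev cs"] by (auto simp: ts_cs)
  ultimately show ?R by (intro exI[of _ "length cs"] exI[of _ "\<lambda>i. rev cs ! i"]) auto
next
  interpret R: cring "poly_quot g" by (rule poly_quot_cring)
  assume ?R
  then obtain m c where c: "\<And>i. i < m \<Longrightarrow> residue g (c i) \<in> T"
    "g dvd z ^ m + (\<Sum>i<m. c i * z ^ i)" by auto
  define cs where "cs = rev (map c [0..<m])"
  have len: "length cs = m" by (simp add: cs_def)
  have "residue g 1 \<noteq> \<zero>\<^bsub>poly_quot g\<^esub>"
    using g dvd_imp_degree_le[of g 1] by (auto simp: residue_eq_zero_iff)
  hence one: "\<one>\<^bsub>poly_quot g\<^esub> \<noteq> \<zero>\<^bsub>poly_quot g\<^esub>" by (simp add: residue_one)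
  have "(\<Sum>i<length (1 # cs). rev (1 # cs) ! i * z ^ i) = z ^ m + (\<Sum>i<m. c i * z ^ i)"
    by (simp add: len nth_append cs_def add.commute)
  hence "ring.eval (poly_quot g) (map (residue g) (1 # cs)) (residue g z)
          = residue g (z ^ m + (\<Sum>i<m. c i * z ^ i))"
    by (simp only: eval_residue)
  also have "\<dots> = \<zero>\<^bsub>poly_quot g\<^esub>" using c(2) by (simp add: residue_eq_zero_iff)
  finally have "ring.eval (poly_quot g) (map (residue g) (1 # cs)) (residue g z) = \<zero>\<^bsub>poly_quot g\<^esub>" .
  moreover have "map (residue g) (1 # cs) \<in> carrier (univ_poly (poly_quot g) T)"
    using c(1) T(2) one by (auto simp: univ_poly_def polynomial_def residue_one cs_def)
  ultimately show ?L unfolding integral_over_def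
    by (intro bexI[of _ "map (residue g) (1 # cs)"]) (auto simp: residue_one)
qed

section \<open>Integrality of fractions\<close>

text \<open>
  With \<open>R\<close> for the coefficient ring, this is an integral equation for \<open>h/a\<close> over \<open>R[Y]\<close> modulo \<open>f\<close>,
  multiplied by \<open>a ^ m\<close>.  It mentions no denominators, so it makes sense over \<open>R\<close> itself and can be
  compared in different rings that contain \<open>R\<close>.
\<close>

definition integral_fraction :: "'a::idom poly \<Rightarrow> 'a \<Rightarrow> 'a poly \<Rightarrow> bool" where
  "integral_fraction f a h \<longleftrightarrow>
     (\<exists>m c. f dvd h ^ m + (\<Sum>i<m. c i * [:a:] ^ (m - i) * h ^ i))"

lemma integral_equation_scale:
  fixes z a :: "'a::comm_ring_1"
  shows "(a * z) ^ m + (\<Sum>i<m. c i * a ^ (m - i) * (a * z) ^ i)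
           = a ^ m * (z ^ m + (\<Sum>i<m. c i * z ^ i))"
proof -
  have "c i * a ^ (m - i) * (a * z) ^ i = a ^ m * (c i * z ^ i)" if "i < m" for i
  proof -
    have "a ^ m = a ^ (m - i) * a ^ i" using that by (simp flip: power_add)
    thus ?thesis by (simp add: power_mult_distrib mult_ac)
  qed
  thus ?thesis by (simp add: power_mult_distrib distrib_left sum_distrib_left)
qed

text \<open>
  If the coefficients may be any residue classes of elements of \<open>range \<psi>\<close>, they can be
  represented by elements of \<open>range \<psi>\<close> themselves, since the error is divisible by \<open>g\<close>.
\<close>

lemma integral_over_range_iff:
  fixes \<psi> :: "'a::idom \<Rightarrow> 'c::field poly"
  assumes \<psi>: "inj_ring_hom \<psi>" and deg: "Polynomial.degree g > 0"
  shows "integral_over (poly_quot g) (residue g ` range \<psi>) (residue g z)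
           \<longleftrightarrow> (\<exists>m c. g dvd z ^ m + (\<Sum>i<m. \<psi> (c i) * z ^ i))"
proof -
  interpret inj_ring_hom \<psi> by (rule \<psi>)
  have one: "\<one>\<^bsub>poly_quot g\<^esub> \<in> residue g ` range \<psi>"
    using residue_one[of g] hom_one by (metis image_eqI rangeI)
  have "integral_over (poly_quot g) (residue g ` range \<psi>) (residue g z) \<longleftrightarrow>
     (\<exists>m c. (\<forall>i<m. residue g (c i) \<in> residue g ` range \<psi>)
        \<and> g dvd z ^ m + (\<Sum>i<m. c i * z ^ i))"
    by (rule integral_over_residue_iff[OF deg _ one]) (auto simp: poly_quot_carrier)
  also have "\<dots> \<longleftrightarrow> (\<exists>m c. g dvd z ^ m + (\<Sum>i<m. \<psi> (c i) * z ^ i))"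
  proof (intro iffI; elim exE conjE)
    fix m c
    assume c: "\<forall>i<m. residue g (c i) \<in> residue g ` range \<psi>"
      and dvd: "g dvd z ^ m + (\<Sum>i<m. c i * z ^ i)"
    have "\<forall>i. \<exists>d. i < m \<longrightarrow> g dvd \<psi> d - c i"
      using c by (auto simp: image_iff residue_eq_iff) (metis dvd_diff_commute)
    then obtain d where d: "\<And>i. i < m \<Longrightarrow> g dvd \<psi> (d i) - c i" by metis
    have "g dvd (\<Sum>i<m. (\<psi> (d i) - c i) * z ^ i)"
      by (rule dvd_sum) (simp add: d)
    hence "g dvd (z ^ m + (\<Sum>i<m. c i * z ^ i)) + (\<Sum>i<m. (\<psi> (d i) - c i) * z ^ i)"
      using dvd by (rule dvd_add[rotated])
    also have "\<dots> = z ^ m + (\<Sum>i<m. \<psi> (d i) * z ^ i)"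
      by (simp add: left_diff_distrib sum_subtractf)
    finally show "\<exists>m c. g dvd z ^ m + (\<Sum>i<m. \<psi> (c i) * z ^ i)" by blast
  next
    fix m c
    assume "g dvd z ^ m + (\<Sum>i<m. \<psi> (c i) * z ^ i)"
    thus "\<exists>m c. (\<forall>i<m. residue g (c i) \<in> residue g ` range \<psi>)
        \<and> g dvd z ^ m + (\<Sum>i<m. c i * z ^ i)"
      by (intro exI[of _ m] exI[of _ "\<lambda>i. \<psi> (c i)"]) auto
  qed
  finally show ?thesis .
qed

text \<open>
  The two conditions differ by the factor \<open>\<phi> a ^ m\<close>, which is a unit, and divisibility by the monic
  \<open>f\<close> is not affected by \<open>\<phi>\<close>.
\<close>

lemma integral_over_fraction_iff:
  fixes \<phi> :: "'a::idom \<Rightarrow> 'c::field" and f h :: "'a poly"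
  assumes \<phi>: "inj_ring_hom \<phi>" and f: "Polynomial.lead_coeff f = 1" "Polynomial.degree f > 0"
    and a: "a \<noteq> 0"
  defines "g \<equiv> map_poly \<phi> f"
  shows "integral_over (poly_quot g) (residue g ` range (map_poly \<phi>))
           (residue g (Polynomial.smult (inverse (\<phi> a)) (map_poly \<phi> h)))
         \<longleftrightarrow> integral_fraction f a h"
proof -
  interpret inj_ring_hom \<phi> by (rule \<phi>)
  interpret P: inj_ring_hom "map_poly \<phi>" by (rule map_poly_hom)
  define z where "z = Polynomial.smult (inverse (\<phi> a)) (map_poly \<phi> h)"
  have \<phi>a: "\<phi> a \<noteq> 0" using a by (simp add: hom_zero_iff)
  have az: "[:\<phi> a:] * z = map_poly \<phi> h" using \<phi>a by (simp add: z_def)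
  have const: "map_poly \<phi> [:a:] = [:\<phi> a:]" by (simp add: map_poly_pCons hom_zero)
  have unit: "[:\<phi> a:] ^ m dvd 1" for m
    using \<phi>a by (simp add: is_unit_power_iff is_unit_const_poly_iff dvd_field_iff)
  have eq: "g dvd z ^ m + (\<Sum>i<m. map_poly \<phi> (c i) * z ^ i)
       \<longleftrightarrow> f dvd h ^ m + (\<Sum>i<m. c i * [:a:] ^ (m - i) * h ^ i)" for m c
  proof -
    have "map_poly \<phi> (h ^ m + (\<Sum>i<m. c i * [:a:] ^ (m - i) * h ^ i))
        = [:\<phi> a:] ^ m * (z ^ m + (\<Sum>i<m. map_poly \<phi> (c i) * z ^ i))"
      unfolding integral_equation_scale[symmetric] az
      by (simp add: P.hom_add P.hom_sum P.hom_mult P.hom_power const)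
    hence "f dvd h ^ m + (\<Sum>i<m. c i * [:a:] ^ (m - i) * h ^ i)
      \<longleftrightarrow> g dvd [:\<phi> a:] ^ m * (z ^ m + (\<Sum>i<m. map_poly \<phi> (c i) * z ^ i))"
      using map_poly_dvd_iff[OF f(1), of "h ^ m + (\<Sum>i<m. c i * [:a:] ^ (m - i) * h ^ i)"]
      by (simp only: g_def)
    also have "\<dots> \<longleftrightarrow> g dvd z ^ m + (\<Sum>i<m. map_poly \<phi> (c i) * z ^ i)"
      by (rule dvd_mult_unit_iff') (rule unit)
    finally show ?thesis by simp
  qed
  have deg: "Polynomial.degree g > 0" using f(2) by (simp add: g_def)
  have "integral_over (poly_quot g) (residue g ` range (map_poly \<phi>)) (residue g z)
      \<longleftrightarrow> (\<exists>m c. g dvd z ^ m + (\<Sum>i<m. map_poly \<phi> (c i) * z ^ i))"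
    by (rule integral_over_range_iff[OF map_poly_hom deg])
  also have "\<dots> \<longleftrightarrow> integral_fraction f a h"
    by (simp add: eq integral_fraction_def)
  finally show ?thesis by (simp add: z_def)
qed

section \<open>Truncating power series\<close>

lemma poly_fps_truncate:
  fixes R :: "'k::field fps poly"
  shows "\<exists>r R'. R = map_poly fps_of_poly r + [:fps_X ^ N:] * R'"
proof (induction R)
  case 0
  have "0 = map_poly fps_of_poly (0 :: 'k poly poly) + [:fps_X ^ N:] * 0" by simp
  thus ?case by blast
next
  case (pCons a R)
  then obtain r R' where R: "R = map_poly fps_of_poly r + [:fps_X ^ N:] * R'" by blast
  have "fps_of_poly (truncate_fps N a) = fps_cutoff N a"
    by (simp add: fps_eq_iff coeff_truncate_fps)
  hence "a = fps_of_poly (truncate_fps N a) + fps_X ^ N * fps_shift N a"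
    using fps_shift_cutoff'[of N a] by (simp add: add.commute)
  hence "pCons a R = map_poly fps_of_poly (pCons (truncate_fps N a) r)
           + [:fps_X ^ N:] * pCons (fps_shift N a) R'"
    by (simp add: R map_poly_pCons mult.commute)
  thus ?case by blast
qed

lemma fps_X_power_dvd_fps_of_poly:
  fixes u :: "'k::field poly"
  assumes "fps_of_poly u = fps_X ^ N * t"
  shows "[:0, 1:] ^ N dvd u"
proof -
  have "Polynomial.coeff u i = 0" if "i < N" for i
    using arg_cong[OF assms, of "\<lambda>F. fps_nth F i"] that by (simp add: fps_X_power_mult_nth)
  hence "Polynomial.monom 1 N dvd u" by (simp add: monom_1_dvd_iff')
  thus ?thesis by (simp add: monom_altdef)
qed

text \<open>
  Modulo \<open>X ^ N\<close>, a power series is a polynomial.  So the cofactor of \<open>f\<close> can be truncated to a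
  polynomial \<open>s\<close>, and then \<open>f * s - G\<close> is divisible by \<open>X ^ N\<close> over \<open>K[[X]]\<close>, hence over \<open>K[X]\<close>.
\<close>

lemma dvd_modulo_X_power_descends:
  fixes f G :: "'k::field poly poly"
  assumes "map_poly fps_of_poly f dvd map_poly fps_of_poly G + [:fps_X ^ N:] * R"
  shows "\<exists>a. f dvd G + [:[:0, 1:] ^ N:] * a"
proof -
  interpret inj_ring_hom "fps_of_poly :: 'k poly \<Rightarrow> 'k fps" by (rule inj_ring_hom_fps_of_poly)
  interpret P: inj_ring_hom "map_poly (fps_of_poly :: 'k poly \<Rightarrow> 'k fps)" by (rule map_poly_hom)
  let ?t = "map_poly (fps_of_poly :: 'k poly \<Rightarrow> 'k fps)"
  obtain S where S: "?t G + [:fps_X ^ N:] * R = ?t f * S" using assms by blast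
  obtain s S' where s: "S = ?t s + [:fps_X ^ N:] * S'" using poly_fps_truncate by blast
  have eq: "?t (f * s - G) = [:fps_X ^ N:] * (R - ?t f * S')"
    using S unfolding s P.hom_diff P.hom_mult by (simp add: algebra_simps)
  have "[:0, 1:] ^ N dvd Polynomial.coeff (f * s - G) i" for i
  proof (rule fps_X_power_dvd_fps_of_poly)
    show "fps_of_poly (Polynomial.coeff (f * s - G) i)
            = fps_X ^ N * Polynomial.coeff (R - ?t f * S') i"
      using arg_cong[OF eq, of "\<lambda>p. Polynomial.coeff p i"] by (simp add: coeff_hom)
  qed
  hence "[:[:0, 1:] ^ N:] dvd f * s - G" by (simp add: const_poly_dvd_iff)
  then obtain a where "f * s - G = [:[:0, 1:] ^ N:] * a" by blast
  hence "G + [:[:0, 1:] ^ N:] * a = f * s" by (simp add: algebra_simps)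
  thus ?thesis by (metis dvd_triv_left)
qed

text \<open>
  The arithmetic core: \<open>h/X^k\<close> is integral over \<open>K[X,Y]\<close> modulo \<open>f\<close> as soon as it is
  integral over \<open>K[[X]][Y]\<close> modulo \<open>f\<close>.  Truncating the coefficients of an equation over \<open>K[[X]]\<close>
  modulo \<open>X ^ (k * m)\<close> changes its left-hand side by a multiple of \<open>X ^ (k * m)\<close>.  Since the
  constant coefficient enters the equation with the factor \<open>X ^ (k * m)\<close>, it can absorb this error.
\<close>

lemma integral_fraction_fps_iff:
  fixes f h :: "'k::field poly poly"
  assumes f: "Polynomial.lead_coeff f = 1" "Polynomial.degree f > 0"
  shows "integral_fraction (map_poly fps_of_poly f) (fps_X ^ k) (map_poly fps_of_poly h)
           \<longleftrightarrow> integral_fraction f ([:0, 1:] ^ k) h"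
    (is "?L \<longleftrightarrow> ?R")
proof -
  interpret inj_ring_hom "fps_of_poly :: 'k poly \<Rightarrow> 'k fps" by (rule inj_ring_hom_fps_of_poly)
  interpret P: inj_ring_hom "map_poly (fps_of_poly :: 'k poly \<Rightarrow> 'k fps)" by (rule map_poly_hom)
  let ?t = "map_poly (fps_of_poly :: 'k poly \<Rightarrow> 'k fps)"
  define a :: "'k poly poly" where "a = [:[:0, 1:] ^ k:]"
  have ta: "?t a = [:fps_X ^ k:]" by (simp add: a_def map_poly_pCons hom_power)
  have t_eq: "?t (h ^ m + (\<Sum>i<m. c i * a ^ (m - i) * h ^ i))
      = ?t h ^ m + (\<Sum>i<m. ?t (c i) * ?t a ^ (m - i) * ?t h ^ i)" for m c
    by (simp add: P.hom_add P.hom_sum P.hom_mult P.hom_power)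
  show ?thesis
  proof
    assume ?R
    then obtain m c where "f dvd h ^ m + (\<Sum>i<m. c i * a ^ (m - i) * h ^ i)"
      unfolding integral_fraction_def a_def by blast
    hence "?t f dvd ?t (h ^ m + (\<Sum>i<m. c i * a ^ (m - i) * h ^ i))"
      by (simp add: map_poly_dvd_iff[OF f(1)])
    thus ?L unfolding t_eq ta integral_fraction_def
      by (intro exI[of _ m] exI[of _ "\<lambda>i. ?t (c i)"])
  next
    assume ?L
    then obtain m C where C: "?t f dvd ?t h ^ m + (\<Sum>i<m. C i * ?t a ^ (m - i) * ?t h ^ i)"
      unfolding integral_fraction_def ta by blast
    \<comment> \<open>There has to be a constant coefficient that can absorb the error.\<close>
    have m: "m > 0"
    proof (rule Nat.gr0I)
      assume "m = 0"
      hence "?t f dvd 1" using C by simp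
      hence "f dvd 1" using map_poly_dvd_iff[OF f(1), of 1] by simp
      thus False using f(2) dvd_imp_degree_le[of f 1] by simp
    qed
    obtain c D where cD: "\<And>i. C i = ?t (c i) + ?t a ^ m * D i"
    proof -
      have "?t a ^ m = [:fps_X ^ (k * m):]" by (simp add: ta poly_const_pow power_mult)
      hence "\<forall>i. \<exists>r R'. C i = ?t r + ?t a ^ m * R'"
        using poly_fps_truncate[of _ "k * m"] by metis
      thus ?thesis using that by metis
    qed
    define R where "R = (\<Sum>i<m. D i * ?t a ^ (m - i) * ?t h ^ i)"
    have expand: "?t h ^ m + (\<Sum>i<m. C i * ?t a ^ (m - i) * ?t h ^ i)
            = ?t (h ^ m + (\<Sum>i<m. c i * a ^ (m - i) * h ^ i)) + ?t a ^ m * R"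
      unfolding t_eq by (simp add: cD R_def sum_distrib_left sum.distrib algebra_simps)
    have tam: "?t a ^ m = [:fps_X ^ (k * m):]" by (simp add: ta poly_const_pow power_mult)
    have "?t f dvd ?t (h ^ m + (\<Sum>i<m. c i * a ^ (m - i) * h ^ i)) + [:fps_X ^ (k * m):] * R"
      using C by (simp only: expand tam)
    from dvd_modulo_X_power_descends[OF this] obtain b where
      b: "f dvd h ^ m + (\<Sum>i<m. c i * a ^ (m - i) * h ^ i) + [:[:0, 1:] ^ (k * m):] * b"
      by blast
    define c' where "c' = c(0 := c 0 + b)"
    have "(\<Sum>i<m. c' i * a ^ (m - i) * h ^ i)
            = (\<Sum>i<m. c i * a ^ (m - i) * h ^ i + (if i = 0 then b * a ^ m else 0))"
      by (intro sum.cong) (auto simp: c'_def algebra_simps)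
    also have "\<dots> = (\<Sum>i<m. c i * a ^ (m - i) * h ^ i) + b * a ^ m"
      using m by (simp add: sum.distrib)
    also have "b * a ^ m = [:[:0, 1:] ^ (k * m):] * b"
      by (simp add: a_def poly_const_pow power_mult)
    finally have "h ^ m + (\<Sum>i<m. c' i * a ^ (m - i) * h ^ i) =
        h ^ m + (\<Sum>i<m. c i * a ^ (m - i) * h ^ i) + [:[:0, 1:] ^ (k * m):] * b"
      by simp
    with b have "f dvd h ^ m + (\<Sum>i<m. c' i * a ^ (m - i) * h ^ i)" by (simp only:)
    thus ?R unfolding integral_fraction_def a_def
      by (intro exI[of _ m] exI[of _ c'])
  qed
qed

section \<open>Squares of integral elements\<close>

lemma sum_lessThan_double:
  fixes F :: "nat \<Rightarrow> 'a::comm_monoid_add"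
  shows "(\<Sum>i<2 * j. F i) = (\<Sum>i<j. F (2 * i)) + (\<Sum>i<j. F (2 * i + 1))"
  by (induction j) (simp_all add: ac_simps)

lemma poly_monic_expand:
  fixes r :: "'a::comm_semiring_1 poly"
  assumes "Polynomial.degree r = d" "Polynomial.lead_coeff r = 1"
  shows "poly r w = w ^ d + (\<Sum>i<d. Polynomial.coeff r i * w ^ i)"
proof -
  have "poly r w = (\<Sum>i\<le>d. Polynomial.coeff r i * w ^ i)" by (simp add: poly_altdef assms(1))
  also have "{..d} = insert d {..<d}" by auto
  finally show ?thesis using assms by simp
qed

text \<open>
  Separate an equation of even degree \<open>2 * j\<close> for \<open>z\<close> into \<open>E(z^2) + z D(z^2)\<close>, with \<open>E\<close> monic of
  degree \<open>j\<close> and \<open>D\<close> of smaller degree.  Multiplying it by \<open>E(z^2) - z D(z^2)\<close> gives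
  \<open>E(w)^2 - w D(w)^2\<close> at \<open>w = z^2\<close>, a monic equation of degree \<open>2 * j\<close> for the square.  For a set of
  integral elements that is already known to be closed under sums, this yields closure under
  products.
\<close>

lemma (in inj_ring_hom) integral_square:
  assumes "g dvd z ^ m + (\<Sum>i<m. \<phi> (c i) * z ^ i)"
  shows "\<exists>m c. g dvd (z ^ 2) ^ m + (\<Sum>i<m. \<phi> (c i) * (z ^ 2) ^ i)"
proof -
  interpret P: inj_ring_hom "map_poly \<phi>" by (rule map_poly_hom)
  have even: "\<exists>m c. g dvd (z ^ 2) ^ m + (\<Sum>i<m. \<phi> (c i) * (z ^ 2) ^ i)"
    if dvd: "g dvd z ^ (2 * j) + (\<Sum>i<2 * j. \<phi> (c i) * z ^ i)" for j c
  proof -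
    define E1 where "E1 = (\<Sum>i<j. Polynomial.monom (c (2 * i)) i)"
    define E where "E = Polynomial.monom 1 j + E1"
    define D where "D = (\<Sum>i<j. Polynomial.monom (c (2 * i + 1)) i)"
    define r where "r = E ^ 2 - Polynomial.monom 1 1 * D ^ 2"
    define w where "w = z ^ 2"
    have low: "Polynomial.coeff (\<Sum>i<j. Polynomial.monom (q i) i) l = 0" if "l \<ge> j" for l q
      using that by (simp add: coeff_sum)
    have "Polynomial.degree r = 2 * j \<and> Polynomial.lead_coeff r = 1"
    proof (cases "j = 0")
      case True
      thus ?thesis by (simp add: r_def E_def E1_def D_def)
    next
      case False
      have degE1: "Polynomial.degree E1 < j"
        using False low[of _ "\<lambda>i. c (2 * i)"] by (intro degree_lessI) (auto simp: E1_def)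
      have degD: "Polynomial.degree D < j"
        using False low[of _ "\<lambda>i. c (2 * i + 1)"] by (intro degree_lessI) (auto simp: D_def)
      have degE: "Polynomial.degree E = j"
        unfolding E_def using degE1 by (subst degree_add_eq_left) (simp_all add: degree_monom_eq)
      have "Polynomial.coeff E1 j = 0" using degE1 by (rule coeff_eq_0)
      hence leadE: "Polynomial.lead_coeff E = 1" by (simp add: degE) (simp add: E_def)
      hence E0: "E \<noteq> 0" by auto
      have degE2: "Polynomial.degree (E ^ 2) = 2 * j"
        using E0 by (simp add: degree_power_eq degE)
      have "Polynomial.lead_coeff (E ^ 2) = 1"
        by (simp only: lead_coeff_power leadE power_one)
      hence leadE2: "Polynomial.coeff (E ^ 2) (2 * j) = 1" by (simp only: degE2)
      have "Polynomial.degree (Polynomial.monom 1 1 * D ^ 2) \<le> 1 + 2 * Polynomial.degree D"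
        by (rule order.trans[OF degree_mult_le])
           (use degree_power_le[of D 2] in \<open>simp add: degree_monom_eq mult.commute\<close>)
      hence lt: "Polynomial.degree (Polynomial.monom 1 1 * D ^ 2) < 2 * j" using degD by simp
      have degr: "Polynomial.degree r = 2 * j"
        unfolding r_def diff_conv_add_uminus
        using lt by (subst degree_add_eq_left) (simp_all add: degE2)
      have "Polynomial.coeff (Polynomial.monom 1 1 * D ^ 2) (2 * j) = 0"
        using lt by (rule coeff_eq_0)
      hence "Polynomial.coeff r (2 * j) = 1"
        unfolding r_def coeff_diff using leadE2 by simp
      thus ?thesis by (simp add: degr)
    qed
    hence "poly (map_poly \<phi> r) w
        = w ^ (2 * j) + (\<Sum>i<2 * j. Polynomial.coeff (map_poly \<phi> r) i * w ^ i)"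
      by (intro poly_monic_expand) (auto simp: coeff_hom hom_one)
    moreover have "poly (map_poly \<phi> r) w
        = poly (map_poly \<phi> E) w ^ 2 - w * poly (map_poly \<phi> D) w ^ 2"
      by (simp add: r_def P.hom_diff P.hom_power P.hom_mult map_poly_monom hom_zero hom_one
          poly_monom)
    moreover have "\<dots> = (poly (map_poly \<phi> E) w + z * poly (map_poly \<phi> D) w)
        * (poly (map_poly \<phi> E) w - z * poly (map_poly \<phi> D) w)"
      by (simp add: w_def power2_eq_square algebra_simps)
    moreover have "poly (map_poly \<phi> E) w + z * poly (map_poly \<phi> D) w
        = z ^ (2 * j) + (\<Sum>i<2 * j. \<phi> (c i) * z ^ i)"
    proof -
      have "(\<Sum>i<2 * j. \<phi> (c i) * z ^ i)
          = (\<Sum>i<j. \<phi> (c (2 * i)) * w ^ i) + z * (\<Sum>i<j. \<phi> (c (2 * i + 1)) * w ^ i)"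
        by (simp only: sum_lessThan_double)
           (simp add: w_def sum_distrib_left power_mult mult.left_commute)
      thus ?thesis
        by (simp add: E_def E1_def D_def P.hom_add P.hom_sum map_poly_monom hom_zero hom_one
            poly_monom poly_sum) (simp add: w_def power_mult)
    qed
    ultimately have "w ^ (2 * j) + (\<Sum>i<2 * j. Polynomial.coeff (map_poly \<phi> r) i * w ^ i)
        = (z ^ (2 * j) + (\<Sum>i<2 * j. \<phi> (c i) * z ^ i))
            * (poly (map_poly \<phi> E) w - z * poly (map_poly \<phi> D) w)"
      by (simp only:)
    hence "g dvd w ^ (2 * j) + (\<Sum>i<2 * j. Polynomial.coeff (map_poly \<phi> r) i * w ^ i)"
      using dvd_mult2[OF dvd] by (simp only:)
    thus ?thesis unfolding coeff_hom w_def
      by (intro exI[of _ "2 * j"] exI[of _ "Polynomial.coeff r"])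
  qed
  show ?thesis
  proof (cases "even m")
    case True
    then obtain j where "m = 2 * j" by blast
    with assms have "g dvd z ^ (2 * j) + (\<Sum>i<2 * j. \<phi> (c i) * z ^ i)" by (simp only:)
    thus ?thesis by (rule even)
  next
    case False
    \<comment> \<open>Multiplication by \<open>z\<close> makes the degree even.\<close>
    define c' where "c' i = (case i of 0 \<Rightarrow> 0 | Suc i' \<Rightarrow> c i')" for i
    have "z * (z ^ m + (\<Sum>i<m. \<phi> (c i) * z ^ i)) = z ^ Suc m + (\<Sum>i<Suc m. \<phi> (c' i) * z ^ i)"
      by (simp only: sum.lessThan_Suc_shift)
         (simp add: c'_def hom_zero distrib_left sum_distrib_left mult_ac)
    hence "g dvd z ^ Suc m + (\<Sum>i<Suc m. \<phi> (c' i) * z ^ i)"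
      using dvd_mult[OF assms, of z] by (simp only:)
    moreover obtain j where "Suc m = 2 * j" using False by (metis even_Suc evenE)
    ultimately have "g dvd z ^ (2 * j) + (\<Sum>i<2 * j. \<phi> (c' i) * z ^ i)" by (simp only:)
    thus ?thesis by (rule even)
  qed
qed

section \<open>Triangular bases\<close>

lemma residue_polys_range:
  assumes "inj_ring_hom (\<phi> :: 'a::idom \<Rightarrow> 'c::field)"
  shows "residue_polys g (range \<phi>) = residue g ` range (map_poly \<phi>)"
proof -
  interpret inj_ring_hom \<phi> by (rule assms)
  have "h \<in> range (map_poly \<phi>)" if "\<forall>i. Polynomial.coeff h i \<in> range \<phi>" for h
  proof -
    have "map_poly \<phi> (map_poly (inv_into UNIV \<phi>) h) = h"
      using that hom_eq_iff
      by (intro poly_eqI) (simp add: coeff_map_poly f_inv_into_f inv_f_eq inj_def hom_zero)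
    thus ?thesis by (metis rangeI)
  qed
  moreover have "\<forall>i. Polynomial.coeff (map_poly \<phi> h) i \<in> range \<phi>" for h
    by (simp add: coeff_hom)
  ultimately show ?thesis unfolding residue_polys_def by blast
qed

text \<open>
  Polynomials of distinct degrees below \<open>degree g\<close> have distinct residue classes, so that the set of
  generators may be replaced by the family of its elements.
\<close>

lemma module_span_residue:
  fixes g :: "'c::field poly" and \<beta> :: "nat \<Rightarrow> 'c poly"
  assumes g: "Polynomial.degree g = n"
    and \<beta>: "\<And>d. d < n \<Longrightarrow> \<beta> d \<noteq> 0 \<and> Polynomial.degree (\<beta> d) = d"
    and S: "0 \<in> S"
  shows "module_span (poly_quot g) (residue_consts g S) (residue g ` {\<beta> d | d. d < n})
           = {residue g (\<Sum>d<n. Polynomial.smult (c d) (\<beta> d)) | c. \<forall>d<n. c d \<in> S}"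
proof -
  interpret R: cring "poly_quot g" by (rule poly_quot_cring)
  define b where "b d = residue g (\<beta> d)" for d
  have b_closed [simp]: "b d \<in> carrier (poly_quot g)" for d by (simp add: b_def)
  have B: "residue g ` {\<beta> d | d. d < n} = b ` {..<n}" by (auto simp: b_def)
  have inj: "inj_on b {..<n}"
  proof (rule inj_onI; rule ccontr)
    fix d d' assume d: "d \<in> {..<n}" "d' \<in> {..<n}" "b d = b d'" "d \<noteq> d'"
    have "g dvd \<beta> d - \<beta> d'" using d(3) by (simp add: b_def residue_eq_iff)
    moreover have "\<beta> d - \<beta> d' \<noteq> 0" using \<beta>[of d] \<beta>[of d'] d by auto
    ultimately have "n \<le> Polynomial.degree (\<beta> d - \<beta> d')" using g dvd_imp_degree_le by blast
    thus False using \<beta>[of d] \<beta>[of d'] d degree_diff_less[of "\<beta> d" n "\<beta> d'"] by simp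
  qed
  have sum: "residue g (\<Sum>d\<in>I. Polynomial.smult (c d) (\<beta> d))
      = (\<Oplus>\<^bsub>poly_quot g\<^esub>d\<in>I. residue g [:c d:] \<otimes>\<^bsub>poly_quot g\<^esub> b d)" if "finite I" for I c
    using that by (simp add: residue_sum b_def flip: residue_mult)
  show ?thesis
  proof (intro equalityI subsetI)
    fix z assume "z \<in> module_span (poly_quot g) (residue_consts g S) (residue g ` {\<beta> d | d. d < n})"
    then obtain F k where F: "finite F" "F \<subseteq> b ` {..<n}" "k \<in> F \<rightarrow> residue_consts g S"
      and z: "z = (\<Oplus>\<^bsub>poly_quot g\<^esub>v\<in>F. k v \<otimes>\<^bsub>poly_quot g\<^esub> v)"
      unfolding module_span_def B by blast
    define I where "I = {d. d < n \<and> b d \<in> F}"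
    have FI: "F = b ` I" and injI: "inj_on b I"
      using F(2) inj by (auto simp: I_def inj_on_def)
    have "\<forall>d\<in>I. \<exists>s\<in>S. k (b d) = residue g [:s:]"
      using F(3) by (auto simp: I_def residue_consts_def Pi_def)
    then obtain s where s: "\<And>d. d \<in> I \<Longrightarrow> s d \<in> S \<and> k (b d) = residue g [:s d:]" by metis
    define c where "c d = (if d \<in> I then s d else 0)" for d
    have "z = (\<Oplus>\<^bsub>poly_quot g\<^esub>d\<in>I. k (b d) \<otimes>\<^bsub>poly_quot g\<^esub> b d)"
      unfolding z FI using s by (intro R.finsum_reindex injI) (auto simp: b_def)
    also have "\<dots> = (\<Oplus>\<^bsub>poly_quot g\<^esub>d\<in>I. residue g [:s d:] \<otimes>\<^bsub>poly_quot g\<^esub> b d)"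
      using s by (intro R.finsum_cong') (auto simp: b_def)
    also have "\<dots> = residue g (\<Sum>d\<in>I. Polynomial.smult (s d) (\<beta> d))"
      by (rule sum[symmetric]) (simp add: I_def)
    also have "(\<Sum>d\<in>I. Polynomial.smult (s d) (\<beta> d)) = (\<Sum>d<n. Polynomial.smult (c d) (\<beta> d))"
      by (rule sum.mono_neutral_cong_left) (auto simp: I_def c_def)
    finally have "z = residue g (\<Sum>d<n. Polynomial.smult (c d) (\<beta> d))" .
    moreover have "\<forall>d<n. c d \<in> S" using s S by (simp add: c_def)
    ultimately show "z \<in> {residue g (\<Sum>d<n. Polynomial.smult (c d) (\<beta> d)) | c. \<forall>d<n. c d \<in> S}"
      by blast
  next
    fix z assume "z \<in> {residue g (\<Sum>d<n. Polynomial.smult (c d) (\<beta> d)) | c. \<forall>d<n. c d \<in> S}"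
    then obtain c where c: "\<forall>d<n. c d \<in> S"
      and z: "z = residue g (\<Sum>d<n. Polynomial.smult (c d) (\<beta> d))" by blast
    define k where "k v = residue g [:c (inv_into {..<n} b v):]" for v
    have kb: "k (b d) = residue g [:c d:]" if "d < n" for d
      using inv_into_f_f[OF inj] that by (simp add: k_def)
    have "z = (\<Oplus>\<^bsub>poly_quot g\<^esub>d\<in>{..<n}. k (b d) \<otimes>\<^bsub>poly_quot g\<^esub> b d)"
      unfolding z sum[OF finite_lessThan]
      by (intro R.finsum_cong') (auto simp: kb)
    also have "\<dots> = (\<Oplus>\<^bsub>poly_quot g\<^esub>v\<in>b ` {..<n}. k v \<otimes>\<^bsub>poly_quot g\<^esub> v)"
      by (rule R.finsum_reindex[symmetric]) (auto simp: inj kb)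
    finally have "z = (\<Oplus>\<^bsub>poly_quot g\<^esub>v\<in>b ` {..<n}. k v \<otimes>\<^bsub>poly_quot g\<^esub> v)" .
    moreover have "k \<in> b ` {..<n} \<rightarrow> residue_consts g S"
      using c by (auto simp: kb residue_consts_def)
    ultimately show "z \<in> module_span (poly_quot g) (residue_consts g S)
        (residue g ` {\<beta> d | d. d < n})"
      unfolding module_span_def B by blast
  qed
qed

lemma smult_sum_right:
  "Polynomial.smult a (\<Sum>i\<in>I. q i) = (\<Sum>i\<in>I. Polynomial.smult a (q i))"
  by (induction I rule: infinite_finite_induct) (simp_all add: smult_add_right)

lemma module_span_residue_add:
  fixes g :: "'c::field poly" and \<beta> :: "nat \<Rightarrow> 'c poly"
  assumes g: "Polynomial.degree g = n"
    and \<beta>: "\<And>d. d < n \<Longrightarrow> \<beta> d \<noteq> 0 \<and> Polynomial.degree (\<beta> d) = d"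
    and S: "0 \<in> S" "\<And>a b. a \<in> S \<Longrightarrow> b \<in> S \<Longrightarrow> a + b \<in> S"
  defines "M \<equiv> module_span (poly_quot g) (residue_consts g S) (residue g ` {\<beta> d | d. d < n})"
  assumes "residue g a \<in> M" "residue g b \<in> M"
  shows "residue g (a + b) \<in> M"
proof -
  have M: "M = {residue g (\<Sum>d<n. Polynomial.smult (c d) (\<beta> d)) | c. \<forall>d<n. c d \<in> S}"
    unfolding M_def by (rule module_span_residue[OF g \<beta> S(1)])
  obtain c where c: "residue g a = residue g (\<Sum>d<n. Polynomial.smult (c d) (\<beta> d))" "\<forall>d<n. c d \<in> S"
    using assms(6) unfolding M by blast
  obtain c' where c': "residue g b = residue g (\<Sum>d<n. Polynomial.smult (c' d) (\<beta> d))" "\<forall>d<n. c' d \<in> S"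
    using assms(7) unfolding M by blast
  have "residue g (a + b) = residue g (\<Sum>d<n. Polynomial.smult (c d + c' d) (\<beta> d))"
    by (simp add: residue_add c(1) c'(1) smult_add_left sum.distrib)
  thus ?thesis unfolding M
    by (intro CollectI exI[of _ "\<lambda>d. c d + c' d"]) (use c(2) c'(2) S(2) in simp)
qed

lemma module_span_residue_smult:
  fixes g :: "'c::field poly" and \<beta> :: "nat \<Rightarrow> 'c poly"
  assumes g: "Polynomial.degree g = n"
    and \<beta>: "\<And>d. d < n \<Longrightarrow> \<beta> d \<noteq> 0 \<and> Polynomial.degree (\<beta> d) = d"
    and S: "0 \<in> S" "\<And>a b. a \<in> S \<Longrightarrow> b \<in> S \<Longrightarrow> a * b \<in> S"
  defines "M \<equiv> module_span (poly_quot g) (residue_consts g S) (residue g ` {\<beta> d | d. d < n})"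
  assumes "residue g a \<in> M" "s \<in> S"
  shows "residue g (Polynomial.smult s a) \<in> M"
proof -
  have M: "M = {residue g (\<Sum>d<n. Polynomial.smult (c d) (\<beta> d)) | c. \<forall>d<n. c d \<in> S}"
    unfolding M_def by (rule module_span_residue[OF g \<beta> S(1)])
  obtain c where c: "residue g a = residue g (\<Sum>d<n. Polynomial.smult (c d) (\<beta> d))" "\<forall>d<n. c d \<in> S"
    using assms(6) unfolding M by blast
  have "residue g (Polynomial.smult s a) = residue g [:s:] \<otimes>\<^bsub>poly_quot g\<^esub> residue g a"
    by (simp flip: residue_mult)
  also have "\<dots> = residue g (\<Sum>d<n. Polynomial.smult (s * c d) (\<beta> d))"
    by (simp add: c(1) smult_sum_right flip: residue_mult)
  finally show ?thesis unfolding M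
    by (intro CollectI exI[of _ "\<lambda>d. s * c d"]) (use c(2) \<open>s \<in> S\<close> S(2) in simp)
qed

text \<open>
  The numerator on the right-hand side comes from the domain of \<open>\<iota>\<close> and does not depend on \<open>\<iota>\<close>.  This is how a
  combination of the \<open>p\<^sub>d / X^e\<^sub>d\<close> is carried from \<open>K(X)[Y]\<close> to \<open>K((X))[Y]\<close> and back.
\<close>

lemma triangular_combination_fraction:
  fixes \<iota> :: "'a::idom \<Rightarrow> 'c::field" and e :: "nat \<Rightarrow> int"
  assumes \<iota>: "inj_ring_hom \<iota>" and t: "t \<noteq> 0" and M: "\<And>d. d < n \<Longrightarrow> e d \<le> int M"
  shows "(\<Sum>d<n. Polynomial.smult (\<iota> (c d))
             (Polynomial.smult (inverse (\<iota> t powi e d)) (map_poly \<iota> (p d))))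
       = Polynomial.smult (inverse (\<iota> (t ^ M)))
           (map_poly \<iota> (\<Sum>d<n. Polynomial.smult (c d * t ^ nat (int M - e d)) (p d)))"
proof -
  interpret inj_ring_hom \<iota> by (rule \<iota>)
  interpret P: inj_ring_hom "map_poly \<iota>" by (rule map_poly_hom)
  have t': "\<iota> t \<noteq> 0" using t by (simp add: hom_zero_iff)
  have "inverse (\<iota> t powi e d) = inverse (\<iota> t ^ M) * \<iota> t ^ nat (int M - e d)" if "d < n" for d
  proof -
    have "\<iota> t ^ nat (int M - e d) = \<iota> t powi (int M - e d)"
      using M[OF that] by (simp add: power_int_def)
    also have "\<dots> = \<iota> t ^ M / \<iota> t powi e d"
      using t' by (simp add: power_int_diff)
    finally show ?thesis using t' by (simp add: field_simps)
  qed
  hence "Polynomial.smult (\<iota> (c d)) (Polynomial.smult (inverse (\<iota> t powi e d)) (map_poly \<iota> (p d)))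
      = Polynomial.smult (inverse (\<iota> (t ^ M)))
          (map_poly \<iota> (Polynomial.smult (c d * t ^ nat (int M - e d)) (p d)))" if "d < n" for d
    using that by (simp add: map_poly_smult_hom hom_mult hom_power mult_ac)
  thus ?thesis by (simp add: P.hom_sum smult_sum_right)
qed

text \<open>
  The coefficient of \<open>Y ^ (n - 1)\<close> in \<open>G\<close> is the last coefficient of the combination, up to a power
  of \<open>X\<close>.  So that one is a power series which becomes a polynomial after multiplication by a power
  of \<open>X\<close>, hence a polynomial; subtract the last term and repeat.
\<close>

lemma triangular_coefficients_polynomial:
  fixes p :: "nat \<Rightarrow> 'k::field poly poly" and c :: "nat \<Rightarrow> 'k fps"
  assumes p: "\<And>d. d < n \<Longrightarrow> Polynomial.degree (p d) = d \<and> Polynomial.lead_coeff (p d) = 1"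
    and eq: "map_poly fps_of_poly G
       = (\<Sum>d<n. Polynomial.smult (c d * fps_X ^ u d) (map_poly fps_of_poly (p d)))"
    and d: "d < n"
  shows "\<exists>b. c d = fps_of_poly b"
  using assms
proof (induction n arbitrary: G)
  case 0
  thus ?case by simp
next
  case (Suc n)
  interpret inj_ring_hom "fps_of_poly :: 'k poly \<Rightarrow> 'k fps" by (rule inj_ring_hom_fps_of_poly)
  interpret P: inj_ring_hom "map_poly (fps_of_poly :: 'k poly \<Rightarrow> 'k fps)" by (rule map_poly_hom)
  have p: "Polynomial.degree (p d) = d" "Polynomial.coeff (p d) d = 1" if "d < Suc n" for d
    using Suc.prems(1)[OF that] by auto
  have "Polynomial.coeff (p d) n = 0" if "d < n" for d
    using that p(1)[of d] by (simp add: coeff_eq_0)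
  hence "Polynomial.coeff (map_poly fps_of_poly G) n = c n * fps_X ^ u n"
    by (simp add: Suc.prems(2) coeff_sum coeff_hom p hom_one)
  hence top: "fps_of_poly (Polynomial.coeff G n) = fps_X ^ u n * c n"
    by (simp add: coeff_hom mult.commute)
  then obtain b where b: "Polynomial.coeff G n = [:0, 1:] ^ u n * b"
    using fps_X_power_dvd_fps_of_poly by (metis dvdE)
  have cn: "c n = fps_of_poly b"
    using top by (simp add: b hom_mult hom_power)
  show ?case
  proof (cases "d = n")
    case True
    thus ?thesis using cn by blast
  next
    case False
    have "map_poly fps_of_poly (G - Polynomial.smult (b * [:0, 1:] ^ u n) (p n))
       = (\<Sum>d<n. Polynomial.smult (c d * fps_X ^ u d) (map_poly fps_of_poly (p d)))"
      by (simp add: P.hom_diff Suc.prems(2) map_poly_smult_hom hom_mult hom_power cn)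
    moreover have "Polynomial.degree (p d) = d \<and> Polynomial.lead_coeff (p d) = 1" if "d < n" for d
      by (rule Suc.prems(1)) (use that in simp)
    moreover have "d < n" using Suc.prems(3) False by simp
    ultimately show ?thesis using Suc.IH by blast
  qed
qed

text \<open>
  The span over \<open>K[x]\<close> consists of the elements \<open>h/x^k\<close> of \<open>A[1/x]\<close> that are integral over \<open>A\<close>.  By
  \<open>integral_fraction_fps_iff\<close> integrality can be tested in \<open>K((X))[Y]/\<langle>f\<rangle>\<close>, where the integral
  elements are the combinations of the basis over \<open>K[[x]]\<close>; and a combination that equals \<open>h/x^k\<close> has
  its coefficients in \<open>K[x]\<close>, because the basis is triangular.
\<close>

theorem module_span_integral_basis:
  fixes f :: "'k::field poly poly"
  assumes f: "Polynomial.lead_coeff f = 1" "Polynomial.degree f = n" "n > 0"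
    and tri: "monic_triangular_data n p e"
    and basis: "represents_integral_basis f (quotient_family emb_laurent n p e)"
  shows "module_span (function_field f) (K_x f)
           (residue (map_poly emb_ratfun f) ` quotient_family emb_ratfun n p e)
     = {residue (map_poly emb_ratfun f)
           (Polynomial.smult (inverse (emb_ratfun ([:0, 1:] ^ k))) (map_poly emb_ratfun h))
         | k h. integral_fraction f ([:0, 1:] ^ k) h}"
proof -
  define \<xi> :: "'k poly" where xi_def: "\<xi> = [:0, 1:]"
  have xi0: "\<xi> \<noteq> 0" by (simp add: xi_def)
  let ?T = "map_poly (fps_of_poly :: 'k poly \<Rightarrow> 'k fps)"
  let ?U = "map_poly (fps_to_fls :: 'k fps \<Rightarrow> 'k fls)"
  let ?E = "map_poly (emb_laurent :: 'k poly \<Rightarrow> 'k fls)"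
  interpret q: inj_ring_hom "to_fract :: 'k poly \<Rightarrow> 'k poly fract" by (rule inj_ring_hom_to_fract)
  interpret Q: inj_ring_hom "fract_poly :: 'k poly poly \<Rightarrow> _" by (rule q.map_poly_hom)
  interpret t: inj_ring_hom "fps_of_poly :: 'k poly \<Rightarrow> 'k fps" by (rule inj_ring_hom_fps_of_poly)
  interpret T: inj_ring_hom ?T by (rule t.map_poly_hom)
  interpret u: inj_ring_hom "fps_to_fls :: 'k fps \<Rightarrow> 'k fls" by (rule inj_ring_hom_fps_to_fls)
  interpret U: inj_ring_hom ?U by (rule u.map_poly_hom)
  interpret l: inj_ring_hom "emb_laurent :: 'k poly \<Rightarrow> 'k fls" by (rule inj_ring_hom_emb_laurent)
  have UT: "?E h = ?U (?T h)" for h :: "'k poly poly"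
    by (rule poly_eqI) (simp add: l.coeff_hom t.coeff_hom u.coeff_hom)
  define gK where "gK = map_poly emb_ratfun f"
  define gL where "gL = ?E f"
  define bK where "bK d = Polynomial.smult (inverse (emb_ratfun \<xi> powi e d)) (map_poly emb_ratfun (p d))" for d
  define bL where "bL d = Polynomial.smult (inverse (emb_laurent \<xi> powi e d)) (?E (p d))" for d
  define frK where "frK k h = Polynomial.smult (inverse (emb_ratfun (\<xi> ^ k))) (map_poly emb_ratfun h)" for k h
  define frL where "frL k h = Polynomial.smult (inverse (emb_laurent (\<xi> ^ k))) (?E h)" for k h
  have p: "Polynomial.degree (p d) = d" "Polynomial.lead_coeff (p d) = 1" "p d \<noteq> 0" if "d < n" for d
    using tri that by (force simp: monic_triangular_data_def)+
  have degK: "Polynomial.degree gK = n" and degL: "Polynomial.degree gL = n"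
    using f(2) by (simp_all add: gK_def gL_def)
  have emb_xi: "emb_laurent \<xi> \<noteq> 0" "emb_ratfun \<xi> \<noteq> 0"
    using xi0 by (simp_all add: l.hom_zero_iff q.hom_zero_iff)
  have "bK d \<noteq> 0 \<and> Polynomial.degree (bK d) = d" if "d < n" for d
    using that p[of d] emb_xi q.hom_zero_iff by (simp add: bK_def Q.hom_zero_iff)
  note spanK = module_span_residue[OF degK this]
  have bL: "bL d \<noteq> 0 \<and> Polynomial.degree (bL d) = d" if "d < n" for d
    using that p[of d] emb_xi inj_ring_hom.hom_zero_iff[OF l.map_poly_hom] by (simp add: bL_def)
  note spanL = module_span_residue[OF degL this]
  \<comment> \<open>A common exponent for the denominators \<open>X^k\<close> and \<open>X^e\<^sub>d\<close>.\<close>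
  define M where "M k = k + nat (\<Sum>d<n. \<bar>e d\<bar>)" for k
  have M: "e d \<le> int (M k)" if "d < n" for d k
  proof -
    have "e d \<le> \<bar>e d\<bar>" by simp
    also have "\<dots> \<le> (\<Sum>d<n. \<bar>e d\<bar>)" by (rule member_le_sum) (use that in auto)
    finally show ?thesis by (simp add: M_def)
  qed
  define G where "G k c = (\<Sum>d<n. Polynomial.smult (c d * \<xi> ^ nat (int (M k) - e d)) (p d))" for k c
  have combK: "(\<Sum>d<n. Polynomial.smult (emb_ratfun (c d)) (bK d)) = frK (M k) (G k c)" for c k
    unfolding bK_def frK_def G_def
    by (rule triangular_combination_fraction[OF inj_ring_hom_to_fract xi0 M])
  have combL: "(\<Sum>d<n. Polynomial.smult (emb_laurent (c d)) (bL d)) = frL (M k) (G k c)" for c k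
    unfolding bL_def frL_def G_def
    by (rule triangular_combination_fraction[OF inj_ring_hom_emb_laurent xi0 M])
  have closure: "integral_closure (laurent_quot f) (power_series_quot f)
      = {residue gL (\<Sum>d<n. Polynomial.smult (c d) (bL d)) | c. \<forall>d<n. c d \<in> range fps_to_fls}"
  proof -
    have "residue gL ` quotient_family emb_laurent n p e = residue gL ` {bL d | d. d < n}"
      by (simp add: quotient_family_def bL_def xi_def)
    moreover have "0 \<in> range (fps_to_fls :: 'k fps \<Rightarrow> 'k fls)"
      by (metis rangeI fps_zero_to_fls)
    ultimately show ?thesis
      using basis spanL
      by (simp add: represents_integral_basis_def free_generators_def K_xx_def laurent_quot_def gL_def)
  qed
  have integral_iff: "residue gL (frL k h) \<in> integral_closure (laurent_quot f) (power_series_quot f)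
      \<longleftrightarrow> integral_fraction f (\<xi> ^ k) h" for k h
  proof -
    have fr: "frL k h = Polynomial.smult (inverse (fps_to_fls (fps_X ^ k))) (?U (?T h))"
      by (simp add: frL_def UT t.hom_power xi_def)
    have "integral_over (poly_quot gL) (residue gL ` range ?U) (residue gL (frL k h))
        \<longleftrightarrow> integral_fraction (?T f) (fps_X ^ k) (?T h)"
      unfolding fr gL_def UT
      by (rule integral_over_fraction_iff[OF inj_ring_hom_fps_to_fls])
         (use f in \<open>simp_all add: t.coeff_hom t.hom_one\<close>)
    also have "\<dots> \<longleftrightarrow> integral_fraction f (\<xi> ^ k) h"
      unfolding xi_def by (rule integral_fraction_fps_iff) (use f in simp_all)
    finally show ?thesis
      by (simp add: integral_closure_def laurent_quot_def power_series_quot_def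
          residue_polys_range[OF inj_ring_hom_fps_to_fls] flip: gL_def)
  qed
  have integralK_iff: "integral_over (poly_quot gK) (residue gK ` range (map_poly emb_ratfun))
      (residue gK (frK k h)) \<longleftrightarrow> integral_fraction f (\<xi> ^ k) h" for k h
    unfolding frK_def gK_def
    by (rule integral_over_fraction_iff[OF inj_ring_hom_to_fract]) (use f xi0 in simp_all)
  have "residue gK ` quotient_family emb_ratfun n p e = residue gK ` {bK d | d. d < n}"
    by (simp add: quotient_family_def bK_def xi_def)
  moreover have "0 \<in> range (emb_ratfun :: 'k poly \<Rightarrow> _)"
    by (metis rangeI to_fract_0)
  ultimately have "module_span (function_field f) (K_x f)
           (residue gK ` quotient_family emb_ratfun n p e)
     = {residue gK (\<Sum>d<n. Polynomial.smult (c d) (bK d)) | c. \<forall>d<n. c d \<in> range emb_ratfun}"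
    using spanK by (simp add: function_field_def K_x_def gK_def)
  also have "\<dots> = {residue gK (frK k h) | k h. integral_fraction f (\<xi> ^ k) h}"
  proof (intro equalityI subsetI)
    fix z assume "z \<in> {residue gK (\<Sum>d<n. Polynomial.smult (c d) (bK d)) | c. \<forall>d<n. c d \<in> range emb_ratfun}"
    then obtain c where c: "\<forall>d<n. c d \<in> range emb_ratfun"
      and z: "z = residue gK (\<Sum>d<n. Polynomial.smult (c d) (bK d))" by blast
    from c have "\<forall>d. \<exists>b. d < n \<longrightarrow> c d = emb_ratfun b" by blast
    then obtain b where b: "\<And>d. d < n \<Longrightarrow> c d = emb_ratfun (b d)" by metis
    have "z = residue gK (frK (M 0) (G 0 b))"
      unfolding z combK[symmetric] by (simp add: b)
    moreover have "residue gL (\<Sum>d<n. Polynomial.smult (emb_laurent (b d)) (bL d))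
        \<in> integral_closure (laurent_quot f) (power_series_quot f)"
      unfolding closure by (intro CollectI exI[of _ "\<lambda>d. emb_laurent (b d)"]) auto
    hence "integral_fraction f (\<xi> ^ M 0) (G 0 b)"
      by (simp only: combL[of b 0] integral_iff)
    ultimately show "z \<in> {residue gK (frK k h) | k h. integral_fraction f (\<xi> ^ k) h}" by blast
  next
    fix z assume "z \<in> {residue gK (frK k h) | k h. integral_fraction f (\<xi> ^ k) h}"
    then obtain k h where z: "z = residue gK (frK k h)" and h: "integral_fraction f (\<xi> ^ k) h"
      by blast
    \<comment> \<open>The representative \<open>r\<close> of degree below \<open>n\<close> turns the congruence modulo \<open>f\<close> below into an equality.\<close>
    obtain s' r where r': "h = f * s' + r" "r = 0 \<or> Polynomial.degree r < Polynomial.degree f"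
      by (rule monic_division[OF f(1)])
    have r: "f dvd h - r" "Polynomial.degree r < n" using r' f(2,3) by auto
    have "frK k h - frK k r = Polynomial.smult (inverse (emb_ratfun (\<xi> ^ k))) (fract_poly (h - r))"
      by (simp add: frK_def Q.hom_diff smult_diff_right)
    moreover have "gK dvd fract_poly (h - r)"
      unfolding gK_def using r(1) by (simp only: q.map_poly_dvd_iff[OF f(1)])
    ultimately have zr: "z = residue gK (frK k r)"
      unfolding z by (simp add: residue_eq_iff dvd_smult)
    have "integral_fraction f (\<xi> ^ k) r"
      using h by (simp only: integralK_iff[symmetric] zr[symmetric] z)
    hence "residue gL (frL k r) \<in> integral_closure (laurent_quot f) (power_series_quot f)"
      by (simp only: integral_iff)
    then obtain c' where c': "\<forall>d<n. c' d \<in> range fps_to_fls"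
      "residue gL (frL k r) = residue gL (\<Sum>d<n. Polynomial.smult (c' d) (bL d))"
      unfolding closure by blast
    from c'(1) have "\<forall>d. \<exists>b. d < n \<longrightarrow> c' d = fps_to_fls b" by blast
    then obtain c where c: "\<And>d. d < n \<Longrightarrow> c' d = fps_to_fls (c d)" by metis
    define s where "s = (\<Sum>d<n. Polynomial.smult (fps_to_fls (c d)) (bL d))"
    have "gL dvd frL k r - s"
      using c'(2) by (simp add: s_def residue_eq_iff c)
    moreover have "Polynomial.degree (frL k r - s) < n"
    proof (rule degree_diff_less)
      show "Polynomial.degree (frL k r) < n"
        unfolding frL_def using r(2) degree_smult_le[of _ "?E r"] by (metis l.degree_hom le_less_trans)
      show "Polynomial.degree s < n" unfolding s_def
      proof (rule degree_sum_less)
        show "Polynomial.degree (Polynomial.smult (fps_to_fls (c d)) (bL d)) < n"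
          if "d \<in> {..<n}" for d
          using bL[of d] that degree_smult_le[of "fps_to_fls (c d)" "bL d"] by simp
      qed (rule f(3))
    qed
    ultimately have eq: "frL k r = s"
      using dvd_imp_degree_le[of gL "frL k r - s"] degL by fastforce
    define H where "H = (\<Sum>d<n. Polynomial.smult (c d * fps_X ^ nat (int (M k) - e d)) (?T (p d)))"
    have "s = Polynomial.smult (inverse (fps_to_fls (fps_X ^ M k))) (?U H)"
      unfolding s_def H_def bL_def UT xi_def fps_of_poly_fps_X
      by (rule triangular_combination_fraction[OF inj_ring_hom_fps_to_fls _ M]) simp_all
    hence "Polynomial.smult (emb_laurent \<xi> ^ M k) (frL k r) = ?U H"
      using emb_xi by (simp add: eq u.hom_power xi_def)
    moreover have "emb_laurent \<xi> ^ M k * inverse (emb_laurent \<xi> ^ k) = emb_laurent \<xi> ^ (M k - k)"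
      using emb_xi by (simp add: power_diff M_def field_simps power_add)
    hence "Polynomial.smult (emb_laurent \<xi> ^ M k) (frL k r)
        = Polynomial.smult (emb_laurent \<xi> ^ (M k - k)) (?E r)"
      by (simp only: frL_def smult_smult l.hom_power)
    hence "Polynomial.smult (emb_laurent \<xi> ^ M k) (frL k r)
        = ?U (?T (Polynomial.smult (\<xi> ^ (M k - k)) r))"
      by (simp add: UT[symmetric] l.map_poly_smult_hom l.hom_power)
    ultimately have "?U (?T (Polynomial.smult (\<xi> ^ (M k - k)) r)) = ?U H"
      by (simp only:)
    hence TG: "?T (Polynomial.smult (\<xi> ^ (M k - k)) r) = H"
      by (simp add: U.hom_eq_iff)
    have "\<exists>b. c d = fps_of_poly b" if "d < n" for d
      using p TG that unfolding H_def by (intro triangular_coefficients_polynomial[of n p]) auto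
    then obtain b where b: "\<And>d. d < n \<Longrightarrow> c d = fps_of_poly (b d)" by metis
    have "H = ?T (G k b)"
      unfolding H_def G_def
      by (simp add: T.hom_sum t.map_poly_smult_hom t.hom_mult t.hom_power b xi_def)
    hence "Polynomial.smult (\<xi> ^ (M k - k)) r = G k b"
      using TG by (simp only: T.hom_eq_iff)
    moreover have "inverse (emb_ratfun \<xi> ^ M k) * emb_ratfun \<xi> ^ (M k - k) = inverse (emb_ratfun \<xi> ^ k)"
      using emb_xi by (simp add: power_diff M_def field_simps power_add)
    hence "frK (M k) (Polynomial.smult (\<xi> ^ (M k - k)) r) = frK k r"
      by (simp only: frK_def q.map_poly_smult_hom smult_smult q.hom_power)
    ultimately have "frK (M k) (G k b) = frK k r" by (simp only:)
    hence "z = residue gK (\<Sum>d<n. Polynomial.smult (emb_ratfun (b d)) (bK d))"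
      by (simp only: combK[of b k] zr)
    thus "z \<in> {residue gK (\<Sum>d<n. Polynomial.smult (c d) (bK d)) | c. \<forall>d<n. c d \<in> range emb_ratfun}"
      by (intro CollectI exI[of _ "\<lambda>d. emb_ratfun (b d)"]) simp
  qed
  finally show ?thesis by (simp only: gK_def frK_def xi_def)
qed

section \<open>The function field\<close>

lemma clear_denominators:
  fixes a :: "'a::idom fract poly"
  shows "\<exists>c A. c \<noteq> 0 \<and> Polynomial.smult (to_fract c) a = fract_poly A"
proof (induction a)
  case 0
  show ?case by (intro exI[of _ 1] exI[of _ 0]) simp
next
  case (pCons q a)
  then obtain c A where c: "c \<noteq> 0" "Polynomial.smult (to_fract c) a = fract_poly A" by blast
  obtain u v where q: "q = to_fract u / to_fract v" "v \<noteq> 0"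
    by (metis Fract_cases Fract_conv_to_fract)
  have "Polynomial.smult (to_fract (v * c)) (pCons q a)
          = fract_poly (pCons (c * u) (Polynomial.smult v A))"
    using q by (simp add: map_poly_pCons mult_ac flip: c(2))
  thus ?case using c(1) q(2) by (metis no_zero_divisors)
qed

lemma irreducible_divisor_exists:
  fixes c :: "'k::field poly"
  assumes "Polynomial.degree c > 0"
  shows "\<exists>q. Factorial_Ring.irreducible q \<and> q dvd c"
proof -
  define q where "q = arg_min Polynomial.degree (\<lambda>q. q dvd c \<and> Polynomial.degree q > 0)"
  have q: "q dvd c \<and> Polynomial.degree q > 0"
    unfolding q_def by (rule arg_min_natI[of _ c]) (use assms in simp)
  have min: "Polynomial.degree q \<le> Polynomial.degree r" if "r dvd c" "Polynomial.degree r > 0" for r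
    unfolding q_def by (rule arg_min_nat_le) (use that in simp)
  have "Factorial_Ring.irreducible q"
  proof (rule Factorial_Ring.irreducibleI)
    show "q \<noteq> 0" using q by auto
    show "\<not> q dvd 1" using q dvd_imp_degree_le[of q 1] by auto
    fix a b assume ab: "q = a * b"
    hence nz: "a \<noteq> 0" "b \<noteq> 0" using \<open>q \<noteq> 0\<close> by auto
    hence deg: "Polynomial.degree q = Polynomial.degree a + Polynomial.degree b"
      by (simp add: ab degree_mult_eq)
    have "a dvd c" "b dvd c" using q ab by (auto elim!: dvd_mult_left dvd_mult_right)
    hence "Polynomial.degree a = 0 \<or> Polynomial.degree b = 0"
      using min[of a] min[of b] deg by linarith
    thus "a dvd 1 \<or> b dvd 1" using nz by (simp add: is_unit_iff_degree)
  qed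
  thus ?thesis using q by blast
qed

text \<open>
  Gauss's lemma in the form needed here: a prime divisor of the constant \<open>c\<close> stays prime in
  \<open>K[X][Y]\<close> and hence divides one of the two factors, so \<open>c\<close> can be removed prime by prime.
\<close>

lemma smult_eq_mult_descends:
  fixes f A B :: "'k::field poly poly"
  assumes "c \<noteq> 0" "Polynomial.smult c f = A * B"
  shows "\<exists>A' B'. f = A' * B' \<and> Polynomial.degree A' = Polynomial.degree A
           \<and> Polynomial.degree B' = Polynomial.degree B"
  using assms
proof (induction "Polynomial.degree c" arbitrary: c A B rule: less_induct)
  case less
  show ?case
  proof (cases "Polynomial.degree c = 0")
    case True
    then obtain k where k: "c = [:k:]" "k \<noteq> 0" using less.prems(1) by (auto elim: degree_eq_zeroE)
    have "f = Polynomial.smult ([:inverse k:] * c) f"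
      using k by (simp flip: one_pCons)
    also have "\<dots> = Polynomial.smult [:inverse k:] (A * B)"
      by (simp only: less.prems(2) flip: smult_smult)
    finally have "f = Polynomial.smult [:inverse k:] A * B" by simp
    thus ?thesis using k
      by (intro exI[of _ "Polynomial.smult [:inverse k:] A"] exI[of _ B]) simp
  next
    case False
    then obtain q where q: "Factorial_Ring.irreducible q" "q dvd c"
      using irreducible_divisor_exists by blast
    then obtain c' where c': "c = q * c'" by blast
    have "q \<noteq> 0" using q(1) by auto
    have degq: "Polynomial.degree q > 0"
      using q(1) \<open>q \<noteq> 0\<close> is_unit_iff_degree[of q] by (auto simp: Factorial_Ring.irreducible_def)
    have "c' \<noteq> 0" using less.prems(1) c' by auto
    hence deg: "Polynomial.degree c' < Polynomial.degree c"
      using degq \<open>q \<noteq> 0\<close> by (simp add: c' degree_mult_eq)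
    have cancel: "U = V" if "Polynomial.smult q U = Polynomial.smult q V" for U V
      using that \<open>q \<noteq> 0\<close> smult_diff_right[of q U V] smult_eq_0_iff[of q "U - V"] by simp
    have "prime_elem [:q:]"
      by (rule lift_prime_elem_poly) (rule field_poly_irreducible_imp_prime[OF q(1)])
    moreover have "[:q:] dvd A * B"
    proof -
      have "A * B = [:q:] * Polynomial.smult c' f" by (simp add: c' mult.commute flip: less.prems(2))
      thus ?thesis by (metis dvd_triv_left)
    qed
    ultimately have "[:q:] dvd A \<or> [:q:] dvd B" by (rule prime_elem_dvd_multD)
    thus ?thesis
    proof
      assume "[:q:] dvd A"
      then obtain A1 where A1: "A = Polynomial.smult q A1" by auto
      have "Polynomial.smult c' f = A1 * B"
        by (rule cancel) (use less.prems(2) in \<open>simp add: A1 c'\<close>)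
      from less.hyps[OF deg \<open>c' \<noteq> 0\<close> this] show ?thesis
        using \<open>q \<noteq> 0\<close> by (simp add: A1)
    next
      assume "[:q:] dvd B"
      then obtain B1 where B1: "B = Polynomial.smult q B1" by auto
      have "Polynomial.smult c' f = A * B1"
        by (rule cancel) (use less.prems(2) in \<open>simp add: B1 c'\<close>)
      from less.hyps[OF deg \<open>c' \<noteq> 0\<close> this] show ?thesis
        using \<open>q \<noteq> 0\<close> by (simp add: B1)
    qed
  qed
qed

lemma irreducible_monic_degree_pos:
  fixes f :: "'a::idom poly"
  assumes "Factorial_Ring.irreducible f" "Polynomial.lead_coeff f = 1"
  shows "Polynomial.degree f > 0"
proof (rule Nat.gr0I)
  assume "Polynomial.degree f = 0"
  hence "f = 1" using assms(2) by (auto elim!: degree_eq_zeroE simp: one_pCons)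
  thus False using assms(1) by (simp add: Factorial_Ring.irreducible_def)
qed

lemma irreducible_fract_poly:
  fixes f :: "'k::field poly poly"
  assumes irr: "Factorial_Ring.irreducible f" and monic: "Polynomial.lead_coeff f = 1"
  shows "Factorial_Ring.irreducible (fract_poly f)"
proof (rule Factorial_Ring.irreducibleI)
  interpret q: inj_ring_hom "to_fract :: 'k poly \<Rightarrow> 'k poly fract" by (rule inj_ring_hom_to_fract)
  interpret Q: inj_ring_hom "fract_poly :: 'k poly poly \<Rightarrow> _" by (rule q.map_poly_hom)
  have deg: "Polynomial.degree f > 0" by (rule irreducible_monic_degree_pos[OF irr monic])
  show nz: "fract_poly f \<noteq> 0" using deg by auto
  show "\<not> fract_poly f dvd 1" using deg dvd_imp_degree_le[of "fract_poly f" 1] by auto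
  fix a b assume ab: "fract_poly f = a * b"
  hence nzab: "a \<noteq> 0" "b \<noteq> 0" using nz by auto
  obtain c A where c: "c \<noteq> 0" "Polynomial.smult (to_fract c) a = fract_poly A"
    using clear_denominators by blast
  obtain d B where d: "d \<noteq> 0" "Polynomial.smult (to_fract d) b = fract_poly B"
    using clear_denominators by blast
  have "fract_poly (Polynomial.smult (c * d) f) = fract_poly (A * B)"
    using ab by (simp add: Q.hom_mult mult.commute flip: c(2) d(2))
  hence "Polynomial.smult (c * d) f = A * B" by (simp only: Q.hom_eq_iff)
  then obtain A' B' where f: "f = A' * B'"
    and degs: "Polynomial.degree A' = Polynomial.degree A" "Polynomial.degree B' = Polynomial.degree B"
    using smult_eq_mult_descends[of "c * d"] c(1) d(1) by (metis no_zero_divisors)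
  have "Polynomial.degree A' = 0 \<or> Polynomial.degree B' = 0"
    using Factorial_Ring.irreducibleD[OF irr f] dvd_imp_degree_le[of A' 1] dvd_imp_degree_le[of B' 1]
    by auto
  moreover have "Polynomial.degree A = Polynomial.degree a" "Polynomial.degree B = Polynomial.degree b"
    using arg_cong[OF c(2), of Polynomial.degree] arg_cong[OF d(2), of Polynomial.degree] c(1) d(1)
    by simp_all
  ultimately show "a dvd 1 \<or> b dvd 1" using degs nzab by (simp add: is_unit_iff_degree)
qed

lemma poly_quot_field:
  fixes g :: "'c::field poly"
  assumes irr: "Factorial_Ring.irreducible g"
  shows "field (poly_quot g)"
proof -
  interpret R: cring "poly_quot g" by (rule poly_quot_cring)
  show ?thesis
  proof (rule R.cring_fieldI2)
    have "\<not> g dvd 1" using irr by (simp add: Factorial_Ring.irreducible_def)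
    thus "\<zero>\<^bsub>poly_quot g\<^esub> \<noteq> \<one>\<^bsub>poly_quot g\<^esub>"
      using residue_eq_zero_iff[of g 1] by (auto simp: residue_one)
  next
    fix w assume wc: "w \<in> carrier (poly_quot g)" "w \<noteq> \<zero>\<^bsub>poly_quot g\<^esub>"
    then obtain z where w: "w = residue g z" unfolding poly_quot_carrier by blast
    with wc(2) have z: "\<not> g dvd z" by (simp add: residue_eq_zero_iff)
    \<comment> \<open>An element of least degree in the ideal generated by \<open>z\<close> and \<open>g\<close> divides both.\<close>
    define I where "I = (\<lambda>v. v \<noteq> 0 \<and> (\<exists>a b. v = z * a + g * b))"
    define v where "v = arg_min Polynomial.degree I"
    have "z = z * 1 + g * 0" by simp
    hence "I z" unfolding I_def using z by blast
    hence Iv: "I v" unfolding v_def by (rule arg_min_natI)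
    then obtain a b where v: "v \<noteq> 0" "v = z * a + g * b" unfolding I_def by blast
    have dvd: "v dvd u" if "u = z * a' + g * b'" for u a' b'
    proof (rule ccontr)
      assume "\<not> v dvd u"
      hence nz: "u mod v \<noteq> 0" by (simp add: mod_eq_0_iff_dvd)
      have "u mod v = z * (a' - a * (u div v)) + g * (b' - b * (u div v))"
        using that v(2) minus_mult_div_eq_mod[of u v] by (simp add: algebra_simps)
      with nz have "I (u mod v)" unfolding I_def by blast
      hence "Polynomial.degree v \<le> Polynomial.degree (u mod v)"
        unfolding v_def by (rule arg_min_nat_le)
      thus False using degree_mod_less[OF v(1), of u] nz by simp
    qed
    have "v dvd z" by (rule dvd[of _ 1 0]) simp
    have "v dvd g" by (rule dvd[of _ 0 1]) simp
    then obtain s where s: "g = v * s" by blast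
    from Factorial_Ring.irreducibleD[OF irr s] have "v dvd 1"
    proof
      assume "s dvd 1"
      hence "g dvd v" by (simp add: s mult_unit_dvd_iff)
      thus ?thesis using \<open>v dvd z\<close> z dvd_trans by blast
    qed
    then obtain r where r: "1 = v * r" by blast
    have "g dvd z * (a * r) - 1"
    proof -
      have "z * (a * r) - 1 = g * (- (b * r))"
        unfolding r v(2) by (simp add: algebra_simps)
      thus ?thesis by simp
    qed
    hence "residue g z \<otimes>\<^bsub>poly_quot g\<^esub> residue g (a * r) = \<one>\<^bsub>poly_quot g\<^esub>"
      by (simp add: residue_eq_iff flip: residue_mult residue_one)
    thus "\<exists>b\<in>carrier (poly_quot g). w \<otimes>\<^bsub>poly_quot g\<^esub> b = \<one>\<^bsub>poly_quot g\<^esub>"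
      unfolding w using residue_closed by blast
  qed
qed

section \<open>Localization and integral closure\<close>

text \<open>Multiplying a root by \<open>u\<close> multiplies the coefficient of \<open>z ^ i\<close> by \<open>u ^ (m - i)\<close>.\<close>

lemma integral_over_multiple:
  fixes g :: "'c::field poly"
  assumes g: "Polynomial.degree g > 0"
    and T: "T \<subseteq> carrier (poly_quot g)" "\<one>\<^bsub>poly_quot g\<^esub> \<in> T"
    and dvd: "g dvd z ^ m + (\<Sum>i<m. c i * z ^ i)"
    and c: "\<And>i. i < m \<Longrightarrow> residue g (c i * u ^ (m - i)) \<in> T"
  shows "integral_over (poly_quot g) T (residue g (u * z))"
proof -
  have "g dvd (u * z) ^ m + (\<Sum>i<m. c i * u ^ (m - i) * (u * z) ^ i)"
    unfolding integral_equation_scale using dvd by (rule dvd_mult)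
  thus ?thesis unfolding integral_over_residue_iff[OF g T]
    using c by (intro exI[of _ m] exI[of _ "\<lambda>i. c i * u ^ (m - i)"]) simp
qed

text \<open>
  The ambient field is a quotient \<open>K[Y]/\<langle>g\<rangle>\<close>, so that integral equations can be handled as
  divisibilities by \<open>g\<close>.
\<close>

locale poly_quot_prime =
  fixes g :: "'c::field poly" and A P :: "'c poly set set"
  assumes irr: "Factorial_Ring.irreducible g"
    and A: "subring A (poly_quot g)"
    and P: "primeideal P ((poly_quot g)\<lparr>carrier := A\<rparr>)"
begin

abbreviation L where "L \<equiv> poly_quot g"
abbreviation "A\<^sub>P \<equiv> localization_at L A A P"

sublocale L: field L by (rule poly_quot_field[OF irr])

lemma degree_pos: "Polynomial.degree g > 0"
  using irr is_unit_iff_degree[of g] by (auto simp: Factorial_Ring.irreducible_def)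

lemma A_sub: "A \<subseteq> carrier L" and A_one: "\<one>\<^bsub>L\<^esub> \<in> A"
  and A_mult: "a \<in> A \<Longrightarrow> b \<in> A \<Longrightarrow> a \<otimes>\<^bsub>L\<^esub> b \<in> A"
  and A_minus: "a \<in> A \<Longrightarrow> \<ominus>\<^bsub>L\<^esub> a \<in> A"
  using subringE[OF A] by auto

lemma A_power: "a \<in> A \<Longrightarrow> a [^]\<^bsub>L\<^esub> (k::nat) \<in> A"
  by (induction k) (simp_all add: A_one A_mult)

lemma P_zero: "\<zero>\<^bsub>L\<^esub> \<in> P"
  using additive_subgroup.zero_closed[OF ideal.axioms(1)[OF primeideal.axioms(1)[OF P]]] by simp

lemma P_add: "a \<in> P \<Longrightarrow> b \<in> P \<Longrightarrow> a \<oplus>\<^bsub>L\<^esub> b \<in> P"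
  using additive_subgroup.a_closed[OF ideal.axioms(1)[OF primeideal.axioms(1)[OF P]], of a b] by simp

lemma P_mult: "a \<in> A \<Longrightarrow> b \<in> P \<Longrightarrow> a \<otimes>\<^bsub>L\<^esub> b \<in> P"
  using ideal.I_l_closed[OF primeideal.axioms(1)[OF P], of b a] by simp

lemma P_one: "\<one>\<^bsub>L\<^esub> \<notin> P"
proof -
  interpret P: primeideal P "L\<lparr>carrier := A\<rparr>" by (rule P)
  show ?thesis using P.one_imp_carrier P.I_notcarr by auto
qed

lemma compl_mult: "s \<in> A - P \<Longrightarrow> t \<in> A - P \<Longrightarrow> s \<otimes>\<^bsub>L\<^esub> t \<in> A - P"
proof -
  interpret P: primeideal P "L\<lparr>carrier := A\<rparr>" by (rule P)
  show "s \<in> A - P \<Longrightarrow> t \<in> A - P \<Longrightarrow> s \<otimes>\<^bsub>L\<^esub> t \<in> A - P"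
    using P.I_prime[of s t] A_mult[of s t] by auto
qed

lemma compl_one: "\<one>\<^bsub>L\<^esub> \<in> A - P"
  using A_one P_one by simp

lemma compl_power: "s \<in> A - P \<Longrightarrow> s [^]\<^bsub>L\<^esub> (k::nat) \<in> A - P"
  using compl_one compl_mult[of _ s] by (induction k) auto

lemma compl_unit: "s \<in> A - P \<Longrightarrow> s \<in> Units L"
  using A_sub P_zero L.field_Units by auto

lemma compl_inv [simp]: "s \<in> A - P \<Longrightarrow> inv\<^bsub>L\<^esub> s \<in> carrier L"
  using compl_unit L.Units_inv_closed by blast

lemma localization_iff:
  assumes "M \<subseteq> carrier L"
  shows "z \<in> localization_at L A M P \<longleftrightarrow> z \<in> carrier L \<and> (\<exists>s\<in>A - P. s \<otimes>\<^bsub>L\<^esub> z \<in> M)"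
proof
  assume "z \<in> localization_at L A M P"
  then obtain a s where z: "z = a \<otimes>\<^bsub>L\<^esub> inv\<^bsub>L\<^esub> s" "a \<in> M" "s \<in> A - P"
    unfolding localization_at_def by blast
  have s: "s \<in> Units L" "s \<in> carrier L" using compl_unit[OF z(3)] by auto
  have a: "a \<in> carrier L" using z(2) assms by blast
  have "s \<otimes>\<^bsub>L\<^esub> z = a \<otimes>\<^bsub>L\<^esub> (s \<otimes>\<^bsub>L\<^esub> inv\<^bsub>L\<^esub> s)"
    unfolding z(1) using s a by (intro L.m_lcomm) auto
  hence "s \<otimes>\<^bsub>L\<^esub> z = a" using s a by simp
  hence "s \<otimes>\<^bsub>L\<^esub> z \<in> M" using z(2) by simp
  moreover have "z \<in> carrier L" using z(1) a s by simp
  ultimately show "z \<in> carrier L \<and> (\<exists>s\<in>A - P. s \<otimes>\<^bsub>L\<^esub> z \<in> M)"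
    using z(3) by blast
next
  assume "z \<in> carrier L \<and> (\<exists>s\<in>A - P. s \<otimes>\<^bsub>L\<^esub> z \<in> M)"
  then obtain s where z: "z \<in> carrier L" and s: "s \<in> A - P" "s \<otimes>\<^bsub>L\<^esub> z \<in> M" by blast
  have u: "s \<in> Units L" "s \<in> carrier L" using compl_unit[OF s(1)] by auto
  have "(s \<otimes>\<^bsub>L\<^esub> z) \<otimes>\<^bsub>L\<^esub> inv\<^bsub>L\<^esub> s = z \<otimes>\<^bsub>L\<^esub> (s \<otimes>\<^bsub>L\<^esub> inv\<^bsub>L\<^esub> s)"
    using z u by (simp add: L.m_assoc L.m_lcomm[of s z "inv\<^bsub>L\<^esub> s"])
  hence "z = (s \<otimes>\<^bsub>L\<^esub> z) \<otimes>\<^bsub>L\<^esub> inv\<^bsub>L\<^esub> s" using z u by simp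
  thus "z \<in> localization_at L A M P" unfolding localization_at_def using s by blast
qed

lemma A_loc: "A \<subseteq> A\<^sub>P" "A\<^sub>P \<subseteq> carrier L" "\<one>\<^bsub>L\<^esub> \<in> A\<^sub>P"
proof -
  show "A \<subseteq> A\<^sub>P"
    using A_sub compl_one by (force simp: localization_iff[OF A_sub])
  thus "\<one>\<^bsub>L\<^esub> \<in> A\<^sub>P" using A_one by blast
  show "A\<^sub>P \<subseteq> carrier L" by (auto simp: localization_iff[OF A_sub])
qed

text \<open>
  If \<open>z\<close> satisfies an equation with coefficients \<open>c\<^sub>i\<close> in \<open>A\<close>, then \<open>z/s\<close> satisfies one with the
  coefficients \<open>c\<^sub>i / s^(m-i)\<close>, which lie in \<open>A\<^sub>P\<close>.
\<close>

lemma localization_integral: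
  assumes "M \<subseteq> integral_closure L A"
  shows "localization_at L A M P \<subseteq> integral_closure L A\<^sub>P"
proof
  fix w assume "w \<in> localization_at L A M P"
  then obtain a s where w: "w = a \<otimes>\<^bsub>L\<^esub> inv\<^bsub>L\<^esub> s" and a: "a \<in> M" and s: "s \<in> A - P"
    unfolding localization_at_def by blast
  have ac: "a \<in> carrier L" "integral_over L A a"
    using a assms by (auto simp: integral_closure_def)
  obtain z where z: "a = residue g z" using ac(1) by (auto simp: poly_quot_carrier)
  have su: "s \<in> Units L" "s \<in> carrier L" using compl_unit[OF s] by auto
  obtain u where u: "inv\<^bsub>L\<^esub> s = residue g u" using s compl_inv[OF s] by (auto simp: poly_quot_carrier)
  obtain v where v: "s = residue g v" using su(2) by (auto simp: poly_quot_carrier)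
  have vu: "residue g (v * u) = \<one>\<^bsub>L\<^esub>"
    using su(1) by (simp add: residue_mult flip: u v)
  obtain m c where c: "\<forall>i<m. residue g (c i) \<in> A" "g dvd z ^ m + (\<Sum>i<m. c i * z ^ i)"
    using ac(2) unfolding z integral_over_residue_iff[OF degree_pos A_sub A_one] by blast
  have "integral_over L A\<^sub>P (residue g (u * z))"
  proof (rule integral_over_multiple[OF degree_pos A_loc(2,3) c(2)])
    fix i assume "i < m"
    have "s [^]\<^bsub>L\<^esub> (m - i) \<otimes>\<^bsub>L\<^esub> residue g (c i * u ^ (m - i))
        = residue g (c i) \<otimes>\<^bsub>L\<^esub> residue g (v * u) [^]\<^bsub>L\<^esub> (m - i)"
      by (simp only: v power_mult_distrib mult_ac flip: residue_power residue_mult)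
    also have "\<dots> = residue g (c i)" by (simp add: vu)
    finally have "s [^]\<^bsub>L\<^esub> (m - i) \<otimes>\<^bsub>L\<^esub> residue g (c i * u ^ (m - i)) \<in> A"
      using c(1) \<open>i < m\<close> by simp
    thus "residue g (c i * u ^ (m - i)) \<in> A\<^sub>P"
      unfolding localization_iff[OF A_sub] using compl_power[OF s] residue_closed by blast
  qed
  moreover have "w = residue g (u * z)"
    using ac su by (simp add: w z u residue_mult L.m_comm)
  ultimately show "w \<in> integral_closure L A\<^sub>P" by (simp add: integral_closure_def)
qed

lemma integral_closure_mult:
  assumes a: "a \<in> A" and w: "w \<in> integral_closure L A"
  shows "a \<otimes>\<^bsub>L\<^esub> w \<in> integral_closure L A"
proof -
  obtain z where z: "w = residue g z" using w by (auto simp: integral_closure_def poly_quot_carrier)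
  obtain u where u: "a = residue g u" using a A_sub by (auto simp: poly_quot_carrier)
  obtain m c where c: "\<forall>i<m. residue g (c i) \<in> A" "g dvd z ^ m + (\<Sum>i<m. c i * z ^ i)"
    using w unfolding z integral_closure_def mem_Collect_eq
      integral_over_residue_iff[OF degree_pos A_sub A_one] by blast
  have "integral_over L A (residue g (u * z))"
  proof (rule integral_over_multiple[OF degree_pos A_sub A_one c(2)])
    show "residue g (c i * u ^ (m - i)) \<in> A" if "i < m" for i
      using c(1) that a A_mult A_power by (simp add: residue_mult residue_power flip: u)
  qed
  thus ?thesis by (simp add: integral_closure_def u z flip: residue_mult)
qed

lemma common_denominator:
  fixes m :: nat
  assumes "\<forall>i<m. residue g (c i) \<in> A\<^sub>P"
  shows "\<exists>u. residue g u \<in> A - P \<and> (\<forall>i<m. residue g (u * c i) \<in> A)"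
  using assms
proof (induction m)
  case 0
  have "residue g 1 \<in> A - P" using compl_one by (simp add: residue_one)
  thus ?case by blast
next
  case (Suc m)
  then obtain u where u: "residue g u \<in> A - P" "\<forall>i<m. residue g (u * c i) \<in> A" by auto
  obtain s where s: "s \<in> A - P" "s \<otimes>\<^bsub>L\<^esub> residue g (c m) \<in> A"
    using Suc.prems by (auto simp: localization_iff[OF A_sub])
  obtain v where v: "s = residue g v" using s(1) A_sub by (auto simp: poly_quot_carrier)
  have "residue g (u * v) \<in> A - P"
    using compl_mult u(1) s(1) by (simp add: residue_mult v)
  moreover have "residue g (u * v * c i) \<in> A" if "i < Suc m" for i
  proof (cases "i = m")
    case True
    have "residue g (u * v * c i) = residue g u \<otimes>\<^bsub>L\<^esub> (s \<otimes>\<^bsub>L\<^esub> residue g (c m))"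
      by (simp add: True v residue_mult L.m_assoc)
    thus ?thesis using A_mult u(1) s(2) by simp
  next
    case False
    have "residue g (u * v * c i) = s \<otimes>\<^bsub>L\<^esub> residue g (u * c i)"
      by (simp add: v residue_mult L.m_ac)
    thus ?thesis using A_mult u(2) s(1) False that by simp
  qed
  ultimately show ?case by blast
qed

text \<open>
  If \<open>s\<close> is a common denominator of the coefficients \<open>c\<^sub>i\<close>, then the coefficients
  \<open>c\<^sub>i s^(m-i)\<close> of the equation for \<open>s w\<close> lie in \<open>A\<close>, because \<open>m - i \<ge> 1\<close>.
\<close>

lemma integral_over_localization:
  assumes "w \<in> integral_closure L A\<^sub>P"
  shows "\<exists>s\<in>A - P. s \<otimes>\<^bsub>L\<^esub> w \<in> integral_closure L A"
proof -
  have w: "w \<in> carrier L" "integral_over L A\<^sub>P w" using assms by (auto simp: integral_closure_def)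
  obtain z where z: "w = residue g z" using w(1) by (auto simp: poly_quot_carrier)
  obtain m c where c: "\<forall>i<m. residue g (c i) \<in> A\<^sub>P" "g dvd z ^ m + (\<Sum>i<m. c i * z ^ i)"
    using w(2) unfolding z integral_over_residue_iff[OF degree_pos A_loc(2,3)] by blast
  obtain u where u: "residue g u \<in> A - P" "\<forall>i<m. residue g (u * c i) \<in> A"
    using common_denominator[OF c(1)] by blast
  have "integral_over L A (residue g (u * z))"
  proof (rule integral_over_multiple[OF degree_pos A_sub A_one c(2)])
    fix i assume i: "i < m"
    obtain j where j: "m - i = Suc j" using i by (metis Suc_diff_Suc)
    have "residue g (c i * u ^ (m - i)) = residue g (u * c i) \<otimes>\<^bsub>L\<^esub> residue g u [^]\<^bsub>L\<^esub> j"
      by (simp add: j mult_ac flip: residue_power residue_mult)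
    thus "residue g (c i * u ^ (m - i)) \<in> A"
      using A_mult A_power u i by simp
  qed
  hence "residue g u \<otimes>\<^bsub>L\<^esub> w \<in> integral_closure L A"
    by (simp add: integral_closure_def z flip: residue_mult)
  thus ?thesis using u(1) by blast
qed

text \<open>Here \<open>M\<close> is contained in \<open>A[1/x]\<close>, and \<open>x\<close> is a unit of \<open>A\<^sub>P\<close>.\<close>

lemma localization_away:
  assumes M: "A \<subseteq> M" "M \<subseteq> carrier L" and x: "x \<in> A - P"
    and Mx: "\<And>w. w \<in> M \<Longrightarrow> \<exists>k::nat. x [^]\<^bsub>L\<^esub> k \<otimes>\<^bsub>L\<^esub> w \<in> A"
  shows "localization_at L A M P = A\<^sub>P"
proof (intro equalityI subsetI)
  fix w assume "w \<in> localization_at L A M P"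
  then obtain s where w: "w \<in> carrier L" and s: "s \<in> A - P" "s \<otimes>\<^bsub>L\<^esub> w \<in> M"
    by (auto simp: localization_iff[OF M(2)])
  obtain k :: nat where k: "x [^]\<^bsub>L\<^esub> k \<otimes>\<^bsub>L\<^esub> (s \<otimes>\<^bsub>L\<^esub> w) \<in> A" using Mx[OF s(2)] by blast
  have "x [^]\<^bsub>L\<^esub> k \<otimes>\<^bsub>L\<^esub> s \<in> A - P" by (rule compl_mult[OF compl_power[OF x] s(1)])
  moreover have "(x [^]\<^bsub>L\<^esub> k \<otimes>\<^bsub>L\<^esub> s) \<otimes>\<^bsub>L\<^esub> w \<in> A"
    using k w s(1) x A_sub by (subst L.m_assoc) auto
  ultimately show "w \<in> A\<^sub>P" using w by (auto simp: localization_iff[OF A_sub])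
qed (use M(1) in \<open>auto simp: localization_at_def\<close>)

end

section \<open>The minimal local contribution\<close>

lemma coord_ring_image: "coord_ring f = range (res_class f)"
  by (auto simp: coord_ring_def residue_polys_range[OF inj_ring_hom_to_fract] res_class_def)

lemma subring_coord_ring: "subring (coord_ring f) (function_field f)"
proof -
  interpret q: inj_ring_hom "to_fract :: 'a poly \<Rightarrow> 'a poly fract" by (rule inj_ring_hom_to_fract)
  interpret Q: inj_ring_hom "fract_poly :: 'a poly poly \<Rightarrow> _" by (rule q.map_poly_hom)
  interpret R: cring "function_field f" unfolding function_field_def by (rule poly_quot_cring)
  have hom: "res_class f (a * b) = res_class f a \<otimes>\<^bsub>function_field f\<^esub> res_class f b"
    "res_class f (a + b) = res_class f a \<oplus>\<^bsub>function_field f\<^esub> res_class f b"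
    "res_class f (- a) = \<ominus>\<^bsub>function_field f\<^esub> res_class f a"
    "res_class f 1 = \<one>\<^bsub>function_field f\<^esub>" for a b
    by (simp_all only: res_class_def Q.hom_mult Q.hom_add Q.hom_minus Q.hom_one residue_mult
        residue_add residue_minus residue_one function_field_def)
  show ?thesis
  proof (rule R.subringI)
    show "coord_ring f \<subseteq> carrier (function_field f)"
      by (auto simp: coord_ring_image res_class_def function_field_def)
    show "\<one>\<^bsub>function_field f\<^esub> \<in> coord_ring f"
      by (simp add: coord_ring_image flip: hom(4))
  next
    fix u assume "u \<in> coord_ring f"
    then obtain a where "u = res_class f a" unfolding coord_ring_image by blast
    thus "\<ominus>\<^bsub>function_field f\<^esub> u \<in> coord_ring f"
      by (simp add: coord_ring_image flip: hom(3))
  next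
    fix u v assume "u \<in> coord_ring f" "v \<in> coord_ring f"
    then obtain a b where "u = res_class f a" "v = res_class f b" unfolding coord_ring_image by blast
    thus "u \<otimes>\<^bsub>function_field f\<^esub> v \<in> coord_ring f" "u \<oplus>\<^bsub>function_field f\<^esub> v \<in> coord_ring f"
      by (simp_all add: coord_ring_image flip: hom(1,2))
  qed
qed

theorem proposition43:
  fixes f :: "'k::field_char_0 poly poly" and n :: nat
    and p :: "nat \<Rightarrow> 'k poly poly" and e :: "nat \<Rightarrow> int"
  assumes "Factorial_Ring.irreducible f"
    and "Polynomial.lead_coeff f = 1" and "Polynomial.degree f = n"
    and "origin f \<in> Sing (function_field f) (coord_ring f)"
    and "monic_triangular_data n p e"
    and "represents_integral_basis f (quotient_family emb_laurent n p e)"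
    and "\<And>Q. Q \<in> Sing (function_field f) (coord_ring f) \<Longrightarrow>
              genideal (coord_ring_struct f) {x_class f} \<subseteq> Q \<Longrightarrow> Q = origin f"
  shows "minimal_local_contribution (function_field f) (coord_ring f) (origin f)
           (module_span (function_field f) (K_x f)
              (residue (map_poly emb_ratfun f) ` quotient_family emb_ratfun n p e))"
proof -
  define g where "g = map_poly emb_ratfun f"
  define \<xi> :: "'k poly" where xi_def: "\<xi> = [:0, 1:]"
  define L where "L = poly_quot g"
  define A where "A = coord_ring f"
  define P where "P = origin f"
  define x where "x = x_class f"
  define M where "M = module_span L (K_x f) (residue g ` quotient_family emb_ratfun n p e)"
  define fr where "fr k h = Polynomial.smult (inverse (emb_ratfun (\<xi> ^ k))) (map_poly emb_ratfun h)" for k h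
  interpret q: inj_ring_hom "to_fract :: 'k poly \<Rightarrow> 'k poly fract" by (rule inj_ring_hom_to_fract)
  interpret Q: inj_ring_hom "fract_poly :: 'k poly poly \<Rightarrow> _" by (rule q.map_poly_hom)
  note f = assms(2,3)
  have n: "n > 0" using irreducible_monic_degree_pos[OF assms(1,2)] f(2) by simp
  have L: "function_field f = L" by (simp add: L_def function_field_def g_def)
  have irr: "Factorial_Ring.irreducible g"
    unfolding g_def by (rule irreducible_fract_poly[OF assms(1,2)])
  have A: "subring A L" using subring_coord_ring[of f] by (simp add: L A_def)
  have prime: "poly_quot_prime g A R" if "R \<in> Sing L A" for R
    using irr A that by (intro poly_quot_prime.intro) (simp_all add: Sing_def Spec_def L_def)
  have PSing: "P \<in> Sing L A" using assms(4) by (simp add: P_def L A_def)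
  interpret P: poly_quot_prime g A P by (rule prime[OF PSing])
  note Lsimp = L_def[symmetric]
  have A_range: "A = residue g ` range fract_poly"
    by (auto simp: A_def coord_ring_image res_class_def g_def)
  have xA: "x = residue g [:emb_ratfun \<xi>:]" "x \<in> A"
    by (simp add: x_def x_class_def res_class_def g_def map_poly_pCons xi_def)
       (simp add: x_def x_class_def A_def coord_ring_image)
  have xi0: "emb_ratfun \<xi> \<noteq> 0" by (simp add: xi_def)
  have x_power: "x [^]\<^bsub>L\<^esub> k \<otimes>\<^bsub>L\<^esub> residue g z = residue g (Polynomial.smult (emb_ratfun (\<xi> ^ k)) z)" for k z
    by (simp add: xA(1) L_def poly_const_pow q.hom_power flip: residue_power residue_mult)
  have x_fr: "x [^]\<^bsub>L\<^esub> k \<otimes>\<^bsub>L\<^esub> residue g (fr k h) = residue g (fract_poly h)" for k h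
    using xi0 by (simp add: x_power fr_def q.hom_power)

  \<comment> \<open>\<open>M\<close> is the intersection of \<open>A[1/x]\<close> with the integral closure of \<open>A\<close>.\<close>
  have integral_fr: "integral_over L A (residue g (fr k h)) \<longleftrightarrow> integral_fraction f (\<xi> ^ k) h" for k h
    unfolding L_def A_range g_def fr_def
    by (rule integral_over_fraction_iff[OF inj_ring_hom_to_fract f(1)]) (use f n in \<open>simp_all add: xi_def\<close>)
  have M_fr: "M = {residue g (fr k h) | k h. integral_fraction f (\<xi> ^ k) h}"
    using module_span_integral_basis[OF f n assms(5,6)] by (simp add: M_def L g_def fr_def xi_def)
  have M_iff: "w \<in> M \<longleftrightarrow> w \<in> integral_closure L A \<and> (\<exists>k::nat. x [^]\<^bsub>L\<^esub> k \<otimes>\<^bsub>L\<^esub> w \<in> A)" for w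
  proof
    assume "w \<in> M"
    then obtain k h where w: "w = residue g (fr k h)" "integral_fraction f (\<xi> ^ k) h"
      unfolding M_fr by blast
    have "x [^]\<^bsub>L\<^esub> k \<otimes>\<^bsub>L\<^esub> w \<in> A" by (simp add: w(1) x_fr A_range)
    moreover have "w \<in> integral_closure L A"
      using w by (simp add: integral_closure_def integral_fr) (simp add: L_def)
    ultimately show "w \<in> integral_closure L A \<and> (\<exists>k::nat. x [^]\<^bsub>L\<^esub> k \<otimes>\<^bsub>L\<^esub> w \<in> A)" by blast
  next
    assume w: "w \<in> integral_closure L A \<and> (\<exists>k::nat. x [^]\<^bsub>L\<^esub> k \<otimes>\<^bsub>L\<^esub> w \<in> A)"
    then obtain k :: nat where k: "x [^]\<^bsub>L\<^esub> k \<otimes>\<^bsub>L\<^esub> w \<in> A" by blast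
    obtain z where z: "w = residue g z"
      using w by (auto simp: integral_closure_def L_def poly_quot_carrier)
    obtain h where "x [^]\<^bsub>L\<^esub> k \<otimes>\<^bsub>L\<^esub> w = residue g (fract_poly h)"
      using k unfolding A_range by blast
    hence "g dvd fract_poly h - Polynomial.smult (emb_ratfun (\<xi> ^ k)) z"
      by (simp add: z x_power) (metis residue_eq_iff)
    hence "g dvd Polynomial.smult (inverse (emb_ratfun (\<xi> ^ k)))
        (fract_poly h - Polynomial.smult (emb_ratfun (\<xi> ^ k)) z)"
      by (rule dvd_smult)
    hence "residue g (fr k h) = w"
      using xi0 by (simp add: fr_def z residue_eq_iff smult_diff_right q.hom_power)
    moreover from this have "integral_fraction f (\<xi> ^ k) h"
      using w integral_fr[of k h] by (simp add: integral_closure_def)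
    ultimately show "w \<in> M" unfolding M_fr by blast
  qed
  have M_integral: "M \<subseteq> integral_closure L A" and M_carrier: "M \<subseteq> carrier L"
    by (auto simp: M_iff integral_closure_def)
  have A_M: "A \<subseteq> M"
  proof
    fix w assume w: "w \<in> A"
    obtain z where z: "w = residue g z" using w unfolding A_range by blast
    have "residue g (- z) \<in> A" using P.A_minus[OF w] by (simp add: z residue_minus)
    hence "integral_over L A w"
      unfolding z L_def integral_over_residue_iff[OF P.degree_pos P.A_sub P.A_one]
      by (intro exI[of _ 1] exI[of _ "\<lambda>_. - z"]) simp
    moreover have "w \<in> carrier L" using w P.A_sub by (auto simp: L_def)
    moreover from this have "x [^]\<^bsub>L\<^esub> (0::nat) \<otimes>\<^bsub>L\<^esub> w \<in> A" using w by (simp add: L_def)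
    ultimately show "w \<in> M" unfolding M_iff integral_closure_def by blast
  qed

  \<comment> \<open>\<open>M\<close> is closed under sums because it is a span, and under squares because squares of integral
    elements are integral; then \<open>2ab = (a + b)^2 - a^2 - b^2\<close> gives closure under products.\<close>
  define bK where "bK d = Polynomial.smult (inverse (emb_ratfun \<xi> powi e d)) (map_poly emb_ratfun (p d))" for d
  have bK: "bK d \<noteq> 0 \<and> Polynomial.degree (bK d) = d" if "d < n" for d
  proof -
    have "Polynomial.degree (p d) = d" "Polynomial.lead_coeff (p d) = 1"
      using assms(5) that unfolding monic_triangular_data_def by blast+
    moreover from this have "p d \<noteq> 0" by (metis leading_coeff_0_iff zero_neq_one)
    ultimately show ?thesis using xi0 by (simp add: bK_def Q.hom_zero_iff)
  qed
  have degg: "Polynomial.degree g = n" using f(2) by (simp add: g_def)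
  have M_span: "M = module_span (poly_quot g) (residue_consts g (range emb_ratfun))
      (residue g ` {bK d | d. d < n})"
    by (simp add: M_def L_def K_x_def quotient_family_def bK_def xi_def g_def)
  have range_closed: "0 \<in> range (emb_ratfun :: 'k poly \<Rightarrow> _)"
    "\<And>a b. a \<in> range emb_ratfun \<Longrightarrow> b \<in> range emb_ratfun \<Longrightarrow> a + b \<in> range (emb_ratfun :: 'k poly \<Rightarrow> _)"
    "\<And>a b. a \<in> range emb_ratfun \<Longrightarrow> b \<in> range emb_ratfun \<Longrightarrow> a * b \<in> range (emb_ratfun :: 'k poly \<Rightarrow> _)"
    by (metis rangeI q.hom_zero,
        elim rangeE, simp only: q.hom_add[symmetric] rangeI,
        elim rangeE, simp only: q.hom_mult[symmetric] rangeI)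
  have M_add: "residue g (a + b) \<in> M" if "residue g a \<in> M" "residue g b \<in> M" for a b
    using module_span_residue_add[OF degg bK range_closed(1,2)] that unfolding M_span by blast
  have M_smult: "residue g (Polynomial.smult (emb_ratfun s) a) \<in> M" if "residue g a \<in> M" for a s
    using module_span_residue_smult[OF degg bK range_closed(1,3)] that unfolding M_span by blast
  have M_square: "residue g (a ^ 2) \<in> M" if a: "residue g a \<in> M" for a
  proof -
    obtain k where k: "x [^]\<^bsub>L\<^esub> (k::nat) \<otimes>\<^bsub>L\<^esub> residue g a \<in> A" using a by (auto simp: M_iff)
    have "integral_over L A (residue g a)" using a by (simp add: M_iff integral_closure_def)
    then obtain m c where "g dvd a ^ m + (\<Sum>i<m. fract_poly (c i) * a ^ i)"
      unfolding L_def A_range integral_over_range_iff[OF Q.inj_ring_hom_axioms P.degree_pos] by blast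
    from Q.integral_square[OF this] have "integral_over L A (residue g (a ^ 2))"
      unfolding L_def A_range integral_over_range_iff[OF Q.inj_ring_hom_axioms P.degree_pos] .
    moreover have "x [^]\<^bsub>L\<^esub> (2 * k) \<otimes>\<^bsub>L\<^esub> residue g (a ^ 2)
        = (x [^]\<^bsub>L\<^esub> k \<otimes>\<^bsub>L\<^esub> residue g a) \<otimes>\<^bsub>L\<^esub> (x [^]\<^bsub>L\<^esub> k \<otimes>\<^bsub>L\<^esub> residue g a)"
      unfolding x_power
      by (simp add: L_def power2_eq_square mult_2 power_add flip: residue_mult)
    hence "x [^]\<^bsub>L\<^esub> (2 * k) \<otimes>\<^bsub>L\<^esub> residue g (a ^ 2) \<in> A"
      using P.A_mult[OF k[unfolded L_def] k[unfolded L_def]] by (simp add: L_def)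
    ultimately show ?thesis unfolding M_iff integral_closure_def by (auto simp: L_def)
  qed
  have M_minus: "residue g (- a) \<in> M" if "residue g a \<in> M" for a
    using M_smult[OF that, of "- 1"] by simp
  have M_mult: "residue g (a * b) \<in> M" if ab: "residue g a \<in> M" "residue g b \<in> M" for a b
  proof -
    have "residue g (((a + b) ^ 2 + - (a ^ 2)) + - (b ^ 2)) \<in> M"
      by (intro M_add M_minus M_square ab)
    hence "residue g (Polynomial.smult (emb_ratfun [:inverse 2:]) (((a + b) ^ 2 + - (a ^ 2)) + - (b ^ 2))) \<in> M"
      by (rule M_smult)
    moreover have "Polynomial.smult (emb_ratfun [:inverse 2:]) (((a + b) ^ 2 + - (a ^ 2)) + - (b ^ 2)) = a * b"
    proof -
      define r where "r = emb_ratfun [:inverse (2::'k):]"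
      have "r + r = emb_ratfun ([:inverse 2:] + [:inverse 2:])"
        by (simp only: r_def q.hom_add)
      also have "[:inverse 2:] + [:inverse 2:] = (1 :: 'k poly)" by (simp add: one_pCons)
      finally have half: "r + r = 1" by (simp only: q.hom_one)
      have "((a + b) ^ 2 + - (a ^ 2)) + - (b ^ 2) = a * b + a * b"
        by (simp add: power2_eq_square algebra_simps)
      hence "Polynomial.smult r (((a + b) ^ 2 + - (a ^ 2)) + - (b ^ 2)) = Polynomial.smult (r + r) (a * b)"
        by (simp only: smult_add_left smult_add_right)
      hence "Polynomial.smult r (((a + b) ^ 2 + - (a ^ 2)) + - (b ^ 2)) = a * b"
        by (simp only: half smult_1_left)
      thus ?thesis by (simp only: r_def)
    qed
    ultimately show ?thesis by (simp only:)
  qed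
  have M_lift: "\<exists>a. w = residue g a" if "w \<in> M" for w
    using that M_carrier by (auto simp: L_def poly_quot_carrier)
  have M_subring: "subring M L"
    unfolding L_def
  proof (rule P.L.subringI)
    show "M \<subseteq> carrier (poly_quot g)" using M_carrier by (simp add: L_def)
    show "\<one>\<^bsub>poly_quot g\<^esub> \<in> M" using A_M P.A_one by blast
  next
    fix u assume "u \<in> M"
    thus "\<ominus>\<^bsub>poly_quot g\<^esub> u \<in> M" using M_minus M_lift by (metis residue_minus)
  next
    fix u v assume "u \<in> M" "v \<in> M"
    thus "u \<otimes>\<^bsub>poly_quot g\<^esub> v \<in> M" "u \<oplus>\<^bsub>poly_quot g\<^esub> v \<in> M"
      using M_mult M_add M_lift by (metis residue_mult, metis residue_add)
  qed

  interpret As: ring "L\<lparr>carrier := A\<rparr>"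
    using P.L.subring_is_ring[OF A[unfolded L_def]] by (simp add: L_def)
  have x_P: "x \<in> P"
  proof -
    have "{x, y_class f} \<subseteq> carrier (L\<lparr>carrier := A\<rparr>)"
      using xA(2) by (simp add: y_class_def A_def coord_ring_image)
    from As.genideal_self[OF this] show ?thesis
      by (simp add: P_def origin_def coord_ring_struct_def L A_def x_def)
  qed
  \<comment> \<open>If \<open>v(x)\<close> were in \<open>P\<close>, then so would be the nonzero constant \<open>v(0)\<close>, because \<open>x\<close> is in \<open>P\<close>.\<close>
  have unit_compl: "residue g [:emb_ratfun v:] \<in> A - P" if v: "Polynomial.coeff v 0 \<noteq> 0" for v
  proof
    have const: "residue g [:emb_ratfun c:] \<in> A" for c
    proof -
      have "[:emb_ratfun c:] = fract_poly [:c:]" by (simp add: map_poly_pCons)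
      thus ?thesis unfolding A_range by blast
    qed
    show "residue g [:emb_ratfun v:] \<in> A" by (rule const)
    show "residue g [:emb_ratfun v:] \<notin> P"
    proof
      assume vP: "residue g [:emb_ratfun v:] \<in> P"
      obtain v0 v' where v': "v = pCons v0 v'" by (cases v)
      with v have v0: "v0 \<noteq> 0" by simp
      have "residue g ([:emb_ratfun [:inverse v0:]:] * ([:emb_ratfun v:] + [:emb_ratfun (- v'):] * [:emb_ratfun \<xi>:])) \<in> P"
        unfolding residue_mult residue_add
        by (intro P.P_mult P.P_add const vP x_P[unfolded xA(1)])
      moreover have "[:emb_ratfun [:inverse v0:]:] * ([:emb_ratfun v:] + [:emb_ratfun (- v'):] * [:emb_ratfun \<xi>:])
          = [:emb_ratfun ([:inverse v0:] * (v + - v' * \<xi>)):]"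
      proof -
        have "[:a:] * [:b:] = [:a * b:]" "[:a:] + [:b:] = [:a + b:]" for a b :: "'k poly fract"
          by simp_all
        thus ?thesis by (simp only: q.hom_mult q.hom_add)
      qed
      moreover have "[:inverse v0:] * (v + - v' * \<xi>) = 1"
        using v0 by (simp add: v' xi_def one_pCons)
      ultimately have "residue g [:1:] \<in> P" by (simp only: q.hom_one)
      thus False using P.P_one by (simp add: residue_one flip: one_pCons)
    qed
  qed
  \<comment> \<open>A denominator in \<open>K[x]\<close> factors as \<open>x^k v(x)\<close> with \<open>v(0) \<noteq> 0\<close>, so multiplication by an
    element outside \<open>P\<close> moves any element of \<open>L\<close> into \<open>A[1/x]\<close>.\<close>
  have denominators: "\<exists>k::nat. \<exists>u\<in>A - P. x [^]\<^bsub>L\<^esub> k \<otimes>\<^bsub>L\<^esub> (u \<otimes>\<^bsub>L\<^esub> w) \<in> A" if w: "w \<in> carrier L" for w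
  proof -
    obtain z where z: "w = residue g z" using w by (auto simp: L_def poly_quot_carrier)
    obtain c h where c: "c \<noteq> 0" "Polynomial.smult (emb_ratfun c) z = fract_poly h"
      using clear_denominators by blast
    obtain v where v: "c = [:- 0, 1:] ^ Polynomial.order 0 c * v" "\<not> [:- 0, 1:] dvd v"
      using order_decomp[OF c(1)] by blast
    define k where "k = Polynomial.order 0 c"
    have ck: "c = \<xi> ^ k * v" using v(1) by (simp add: xi_def k_def)
    have "Polynomial.coeff v 0 \<noteq> 0"
      using v(2) by (simp only: flip: poly_eq_0_iff_dvd) (simp add: poly_0_coeff_0)
    hence "residue g [:emb_ratfun v:] \<in> A - P" by (rule unit_compl)
    moreover have "x [^]\<^bsub>L\<^esub> k \<otimes>\<^bsub>L\<^esub> (residue g [:emb_ratfun v:] \<otimes>\<^bsub>L\<^esub> w) = residue g (fract_poly h)"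
    proof -
      have "residue g [:emb_ratfun v:] \<otimes>\<^bsub>L\<^esub> w = residue g (Polynomial.smult (emb_ratfun v) z)"
        by (simp add: z L_def flip: residue_mult)
      thus ?thesis by (simp add: x_power ck q.hom_mult flip: c(2))
    qed
    hence "x [^]\<^bsub>L\<^esub> k \<otimes>\<^bsub>L\<^esub> (residue g [:emb_ratfun v:] \<otimes>\<^bsub>L\<^esub> w) \<in> A"
      unfolding A_range by blast
    ultimately show ?thesis by blast
  qed
  have "localization_at L A M P = integral_closure L (localization_at L A A P)"
  proof (intro equalityI subsetI)
    fix w assume "w \<in> localization_at L A M P"
    thus "w \<in> integral_closure L (localization_at L A A P)"
      using P.localization_integral[of M] M_integral by (auto simp: L_def)
  next
    fix w assume "w \<in> integral_closure L (localization_at L A A P)"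
    hence wc: "w \<in> carrier L" and "\<exists>s\<in>A - P. s \<otimes>\<^bsub>L\<^esub> w \<in> integral_closure L A"
      using P.integral_over_localization[of w] by (simp_all add: L_def integral_closure_def)
    then obtain s where s: "s \<in> A - P" "s \<otimes>\<^bsub>L\<^esub> w \<in> integral_closure L A" by blast
    have sc: "s \<in> carrier L" using s(1) P.A_sub by (auto simp: L_def)
    have swc: "s \<otimes>\<^bsub>L\<^esub> w \<in> carrier L" using sc wc by (simp add: L_def)
    obtain k :: nat and u where u: "u \<in> A - P" "x [^]\<^bsub>L\<^esub> k \<otimes>\<^bsub>L\<^esub> (u \<otimes>\<^bsub>L\<^esub> (s \<otimes>\<^bsub>L\<^esub> w)) \<in> A"
      using denominators[OF swc] by blast
    have uc: "u \<in> carrier L" using u(1) P.A_sub by (auto simp: L_def)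
    have "u \<otimes>\<^bsub>L\<^esub> (s \<otimes>\<^bsub>L\<^esub> w) \<in> integral_closure L A"
      using P.integral_closure_mult[of u "s \<otimes>\<^bsub>L\<^esub> w"] u(1) s(2) by (simp add: L_def)
    hence "u \<otimes>\<^bsub>L\<^esub> (s \<otimes>\<^bsub>L\<^esub> w) \<in> M"
      unfolding M_iff using u(2) by blast
    hence "(u \<otimes>\<^bsub>L\<^esub> s) \<otimes>\<^bsub>L\<^esub> w \<in> M"
      using uc sc wc by (simp add: L_def P.L.m_assoc)
    moreover have "u \<otimes>\<^bsub>L\<^esub> s \<in> A - P" using P.compl_mult[OF u(1) s(1)] by (simp add: L_def)
    ultimately show "w \<in> localization_at L A M P"
      using wc P.localization_iff[OF M_carrier[unfolded L_def]] by (auto simp: L_def)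
  qed
  \<comment> \<open>By assumption \<open>x\<close> lies outside every singular prime other than \<open>P\<close>.\<close>
  moreover have "localization_at L A M R = localization_at L A A R"
    if R: "R \<in> Sing L A" "R \<noteq> P" for R
  proof -
    interpret R: poly_quot_prime g A R by (rule prime[OF R(1)])
    have "x \<notin> R"
    proof
      assume "x \<in> R"
      have "genideal (coord_ring_struct f) {x_class f} \<subseteq> R"
        using As.genideal_minimal[OF primeideal.axioms(1)[OF R.P[folded L_def]], of "{x}"] \<open>x \<in> R\<close>
        by (simp add: coord_ring_struct_def L x_def A_def)
      hence "R = origin f" using assms(7)[of R] R(1) by (simp add: L A_def)
      thus False using R(2) by (simp add: P_def)
    qed
    thus ?thesis
      using R.localization_away[OF A_M M_carrier[unfolded L_def], of x] xA(2) M_iff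
      by (simp add: L_def)
  qed
  ultimately show ?thesis
    unfolding minimal_local_contribution_def local_contribution_def
    using PSing M_subring A_M M_integral
    by (simp add: L A_def P_def M_def g_def)
qed

end
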